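(* The following bilinear maps $\varphi_{j,k}$ ($1\le j\le n+1$, $1\le k\le n$) and $\psi_{j,k}$ ($1\le j\le n$, $1\le k\le n+1$, $(j,k)\ne(n,1)$) on $NF^{n,n+1}$ (values on pairs of basis elements not listed being zero) form a basis of $ZL_0^2(NF^{n,n+1},NF^{n,n+1})$: - $\varphi_{1,1}$: $\varphi_{1,1}(y_1,y_1)=x_1$; $\varphi_{1,1}(x_i,x_1)=-x_{i+1}$ ($1\le i\le n-1$); $\varphi_{1,1}(y_i,x_1)=-y_{i+1}$ ($2\le i\le n$). - $\varphi_{j,1}$ ($2\le j\le n$): $\varphi_{j,1}(y_j,y_1)=x_1$; $\varphi_{j,1}(x_{j-1},x_1)=x_1$; $\varphi_{j,1}(y_j,x_1)=y_2$; $\varphi_{j,1}(x_i,x_j)=-x_{i+1}$ ($1\le i\le n-1$); $\varphi_{j,1}(y_i,x_j)=-y_{i+1}$ ($1\le i\le n$). - $\varphi_{n+1,1}$: $\varphi_{n+1,1}(y_{n+1},y_1)=x_1$; $\varphi_{n+1,1}(x_n,y_1)=-\frac12y_1$; $\varphi_{n+1,1}(y_n,x_1)=-y_1$; $\varphi_{n+1,1}(y_{n+1},x_1)=y_2$; $\varphi_{n+1,1}(x_i,y_{n+1})=-\frac12y_{i+1}$ and $\varphi_{n+1,1}(y_i,y_{n+1})=-x_i$ ($1\le i\le n$). - $\varphi_{1,k}$ ($2\le k\le n$): $\varphi_{1,k}(y_1,y_1)=x_k$; $\varphi_{1,k}(y_1,x_1)=y_{k+1}$. - $\varphi_{j,k}$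 ($2\le j\le n+1$, $2\le k\le n$): $\varphi_{j,k}(y_j,y_1)=x_k$; $\varphi_{j,k}(x_{j-1},x_1)=x_k$; $\varphi_{j,k}(y_j,x_1)=y_{k+1}$. - $\psi_{j,1}$ ($1\le j\le n-1$): $\psi_{j,1}(x_j,y_1)=y_1$; $\psi_{j,1}(x_j,x_1)=2x_1$; $\psi_{j,1}(y_j,x_1)=2y_1$; $\psi_{j,1}(x_i,x_{j+1})=-2x_{i+1}$ ($1\le i\le n-1$); $\psi_{j,1}(y_i,x_{j+1})=-2y_{i+1}$, $\psi_{j,1}(x_i,y_{j+1})=-y_{i+1}$ and $\psi_{j,1}(y_i,y_{j+1})=-2x_i$ ($1\le i\le n$). - $\psi_{j,k}$ ($1\le j\le n$, $2\le k\le n$): $\psi_{j,k}(x_j,y_1)=y_k$; $\psi_{j,k}(x_j,x_1)=2x_k$; $\psi_{j,k}(y_j,x_1)=2y_k$. - $\psi_{j,n+1}$ ($1\le j\le n$): $\psi_{j,n+1}(x_j,y_1)=y_{n+1}$; $\psi_{j,n+1}(y_j,x_1)=2y_{n+1}$.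
   Context: $F$ is a field of characteristic zero. $NF^{n,n+1}$ is the Leibniz superalgebra with even basis $x_1,\dots,x_n$, odd basis $y_1,\dots,y_{n+1}$ and products $[y_i,y_1]=x_i$, $[x_i,y_1]=\frac12y_{i+1}$, $[y_i,x_1]=y_{i+1}$ ($1\le i\le n$), $[x_i,x_1]=x_{i+1}$ ($1\le i\le n-1$), all other products of basis elements being zero. For a Leibniz superalgebra $L=L_0\oplus L_1$ (a $\mathbb Z_2$-graded algebra with $[x,[y,z]]=[[x,y],z]-(-1)^{|y||z|}[[x,z],y]$), the space $ZL_0^2(L,L)$ of even 2-cocycles (infinitesimal deformations) consists of the bilinear maps $\varphi:L\times L\to L$ with $\varphi(L_a,L_b)\subseteq L_{a+b}$ such that for all homogeneous $x,y,z\in L$ $$[x,\varphi(y,z)]-[\varphi(x,y),z]+(-1)^{|y||z|}[\varphi(x,z),y]+\varphi(x,[y,z])-\varphi([x,y],z)+(-1)^{|y||z|}\varphi([x,z],y)=0.$$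
   Formalization: In φ_{n+1,1} the last two signs are corrected: φ_{n+1,1}(x_i,y_{n+1})=+½y_{i+1} and φ_{n+1,1}(y_i,y_{n+1})=+x_i (1≤i≤n); with the printed minus signs the cocycle identity fails at (y_1,y_{n+1},y_1), giving 2y_2. *)

theory Defs
  imports Complex_Main "HOL-Library.Function_Algebras" "HOL-Library.Z2"
begin

section \<open>Leibniz superalgebras and even 2-cocycles\<close>

text \<open>
  A superspace is given by its homogeneous components \<open>L a\<close>, indexed by the
  field \<^typ>\<open>bit\<close> with two elements, inside an ambient vector space.
\<close>

definition whole :: "(bit \<Rightarrow> 'v::ab_group_add set) \<Rightarrow> 'v set" where
  "whole L = {u + v |u v. u \<in> L 0 \<and> v \<in> L 1}"

text \<open>
  A bilinear map \<open>V \<times> V \<rightarrow> V\<close> on a subspace \<open>V\<close> of the ambient type is represented by the function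
  that agrees with it on \<open>V \<times> V\<close> and is 0 elsewhere, so that equality of functions is equality of
  maps, and the pointwise operations are those of the space of bilinear maps.
\<close>

definition bilinear_on :: "('a::field \<Rightarrow> 'v::ab_group_add \<Rightarrow> 'v) \<Rightarrow> 'v set \<Rightarrow> ('v \<Rightarrow> 'v \<Rightarrow> 'v) \<Rightarrow> bool" where
  "bilinear_on scale V f \<longleftrightarrow>
     (\<forall>u\<in>V. \<forall>v\<in>V. f u v \<in> V) \<and>
     (\<forall>u\<in>V. \<forall>u'\<in>V. \<forall>v\<in>V. f (u + u') v = f u v + f u' v) \<and>
     (\<forall>u\<in>V. \<forall>v\<in>V. \<forall>v'\<in>V. f u (v + v') = f u v + f u v') \<and>
     (\<forall>c. \<forall>u\<in>V. \<forall>v\<in>V. f (scale c u) v = scale c (f u v)) \<and>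
     (\<forall>c. \<forall>u\<in>V. \<forall>v\<in>V. f u (scale c v) = scale c (f u v)) \<and>
     (\<forall>u v. u \<notin> V \<or> v \<notin> V \<longrightarrow> f u v = 0)"

definition even_map :: "(bit \<Rightarrow> 'v set) \<Rightarrow> ('v \<Rightarrow> 'v \<Rightarrow> 'v) \<Rightarrow> bool" where
  "even_map L f \<longleftrightarrow> (\<forall>a b. \<forall>u\<in>L a. \<forall>v\<in>L b. f u v \<in> L (a + b))"

definition koszul_sign :: "bit \<Rightarrow> bit \<Rightarrow> 'a::field" where
  "koszul_sign b c = (if b * c = 1 then - 1 else 1)"

locale leibniz_superalgebra = vector_space scale
  for scale :: "'a::field \<Rightarrow> 'v::ab_group_add \<Rightarrow> 'v" +
  fixes L :: "bit \<Rightarrow> 'v set" and br :: "'v \<Rightarrow> 'v \<Rightarrow> 'v"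
  assumes subspace_component: "subspace (L a)"
    and component_Int: "L 0 \<inter> L 1 = {0}"
    and bilinear_bracket: "bilinear_on scale (whole L) br"
    and even_bracket: "even_map L br"
    and leibniz_identity: "\<lbrakk>u \<in> L a; v \<in> L b; w \<in> L c\<rbrakk> \<Longrightarrow>
      br u (br v w) = br (br u v) w - scale (koszul_sign b c) (br (br u w) v)"

definition even_2_cocycles ::
  "('a::field \<Rightarrow> 'v::ab_group_add \<Rightarrow> 'v) \<Rightarrow> (bit \<Rightarrow> 'v set) \<Rightarrow> ('v \<Rightarrow> 'v \<Rightarrow> 'v) \<Rightarrow> ('v \<Rightarrow> 'v \<Rightarrow> 'v) set" where
  "even_2_cocycles scale L br =
     {f. bilinear_on scale (whole L) f \<and> even_map L f \<and>
         (\<forall>a b c. \<forall>u\<in>L a. \<forall>v\<in>L b. \<forall>w\<in>L c.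
            br u (f v w) - br (f u v) w + scale (koszul_sign b c) (br (f u w) v)
            + f u (br v w) - f (br u v) w + scale (koszul_sign b c) (f (br u w) v) = 0)}"


section \<open>The Leibniz superalgebra \<open>NF\<^sup>n\<^sup>,\<^sup>n\<^sup>+\<^sup>1\<close>\<close>

datatype gen = X nat | Y nat

type_synonym 'a vec = "gen \<Rightarrow> 'a"

type_synonym 'a bimap = "'a vec \<Rightarrow> 'a vec \<Rightarrow> 'a vec"

definition vscale :: "'a::field \<Rightarrow> 'a vec \<Rightarrow> 'a vec" where
  "vscale c v = (\<lambda>g. c * v g)"

definition bscale :: "'a::field \<Rightarrow> 'a bimap \<Rightarrow> 'a bimap" where
  "bscale c f = (\<lambda>u v. vscale c (f u v))"

text \<open>The basis vectors \<open>x\<^sub>i\<close> and \<open>y\<^sub>i\<close>:\<close>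

definition xv :: "nat \<Rightarrow> 'a::field vec" where
  "xv i = (\<lambda>g. if g = X i then 1 else 0)"

definition yv :: "nat \<Rightarrow> 'a::field vec" where
  "yv i = (\<lambda>g. if g = Y i then 1 else 0)"

definition NF :: "nat \<Rightarrow> bit \<Rightarrow> 'a::field vec set" where
  "NF n a = {u. \<forall>g. u g \<noteq> 0 \<longrightarrow> g \<in> (if a = 0 then X ` {1..n} else Y ` {1..n+1})}"

text \<open>
  \<open>elem n g h w\<close> is the bilinear map on \<open>NF\<^sup>n\<^sup>,\<^sup>n\<^sup>+\<^sup>1\<close> that sends the pair of basis vectors indexed by
  \<open>(g, h)\<close> to \<open>w\<close> and every other pair of basis vectors to 0.  The bilinear maps below are written as
  sums of such maps, one for each listed product; within each sum the pairs are distinct.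
\<close>

definition elem :: "nat \<Rightarrow> gen \<Rightarrow> gen \<Rightarrow> 'a::field vec \<Rightarrow> 'a bimap" where
  "elem n g h w = (\<lambda>u v. if u \<in> whole (NF n) \<and> v \<in> whole (NF n) then vscale (u g * v h) w else 0)"

definition NF_bracket :: "nat \<Rightarrow> 'a::field bimap" where
  "NF_bracket n =
     (\<Sum>i=1..n. elem n (Y i) (Y 1) (xv i)) +
     (\<Sum>i=1..n. elem n (X i) (Y 1) (vscale (1/2) (yv (i+1)))) +
     (\<Sum>i=1..n. elem n (Y i) (X 1) (yv (i+1))) +
     (\<Sum>i=1..<n. elem n (X i) (X 1) (xv (i+1)))"

abbreviation NF_cocycles :: "nat \<Rightarrow> 'a::field bimap set" where
  "NF_cocycles n \<equiv> even_2_cocycles vscale (NF n) (NF_bracket n)"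


section \<open>The maps \<open>\<phi>\<^sub>j\<^sub>,\<^sub>k\<close> and \<open>\<psi>\<^sub>j\<^sub>,\<^sub>k\<close>\<close>

text \<open>
  The values of \<open>\<phi>\<^sub>n\<^sub>+\<^sub>1\<^sub>,\<^sub>1\<close> on \<open>(x\<^sub>i, y\<^sub>n\<^sub>+\<^sub>1)\<close> and \<open>(y\<^sub>i, y\<^sub>n\<^sub>+\<^sub>1)\<close> are taken to be \<open>+ y\<^sub>i\<^sub>+\<^sub>1/2\<close> and \<open>+ x\<^sub>i\<close>.
  The source prints both with a minus sign, but the resulting map violates the cocycle identity at
  \<open>(y\<^sub>1, y\<^sub>n\<^sub>+\<^sub>1, y\<^sub>1)\<close>; see \<open>phi_printed_not_cocycle\<close> below.  All other values are as printed.
\<close>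

definition phi :: "nat \<Rightarrow> nat \<Rightarrow> nat \<Rightarrow> 'a::field bimap" where
  "phi n j k =
    (if k = 1 then
       (if j = 1 then
          elem n (Y 1) (Y 1) (xv 1) +
          (\<Sum>i=1..<n. elem n (X i) (X 1) (- xv (i+1))) +
          (\<Sum>i=2..n. elem n (Y i) (X 1) (- yv (i+1)))
        else if j \<le> n then
          elem n (Y j) (Y 1) (xv 1) +
          elem n (X (j-1)) (X 1) (xv 1) +
          elem n (Y j) (X 1) (yv 2) +
          (\<Sum>i=1..<n. elem n (X i) (X j) (- xv (i+1))) +
          (\<Sum>i=1..n. elem n (Y i) (X j) (- yv (i+1)))
        else
          elem n (Y (n+1)) (Y 1) (xv 1) +
          elem n (X n) (Y 1) (vscale (-1/2) (yv 1)) +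
          elem n (Y n) (X 1) (- yv 1) +
          elem n (Y (n+1)) (X 1) (yv 2) +
          (\<Sum>i=1..n. elem n (X i) (Y (n+1)) (vscale (1/2) (yv (i+1)))) +
          (\<Sum>i=1..n. elem n (Y i) (Y (n+1)) (xv i)))
     else if j = 1 then
       elem n (Y 1) (Y 1) (xv k) +
       elem n (Y 1) (X 1) (yv (k+1))
     else
       elem n (Y j) (Y 1) (xv k) +
       elem n (X (j-1)) (X 1) (xv k) +
       elem n (Y j) (X 1) (yv (k+1)))"

definition psi :: "nat \<Rightarrow> nat \<Rightarrow> nat \<Rightarrow> 'a::field bimap" where
  "psi n j k =
    (if k = 1 then
       elem n (X j) (Y 1) (yv 1) +
       elem n (X j) (X 1) (vscale 2 (xv 1)) +
       elem n (Y j) (X 1) (vscale 2 (yv 1)) +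
       (\<Sum>i=1..<n. elem n (X i) (X (j+1)) (vscale (-2) (xv (i+1)))) +
       (\<Sum>i=1..n. elem n (Y i) (X (j+1)) (vscale (-2) (yv (i+1)))) +
       (\<Sum>i=1..n. elem n (X i) (Y (j+1)) (- yv (i+1))) +
       (\<Sum>i=1..n. elem n (Y i) (Y (j+1)) (vscale (-2) (xv i)))
     else if k \<le> n then
       elem n (X j) (Y 1) (yv k) +
       elem n (X j) (X 1) (vscale 2 (xv k)) +
       elem n (Y j) (X 1) (vscale 2 (yv k))
     else
       elem n (X j) (Y 1) (yv (n+1)) +
       elem n (Y j) (X 1) (vscale 2 (yv (n+1))))"

definition phi_index :: "nat \<Rightarrow> (nat \<times> nat) set" where
  "phi_index n = {1..n+1} \<times> {1..n}"

definition psi_index :: "nat \<Rightarrow> (nat \<times> nat) set" where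
  "psi_index n = {1..n} \<times> {1..n+1} - {(n, 1)}"

text \<open>The family consisting of all \<open>\<phi>\<^sub>j\<^sub>,\<^sub>k\<close> and all \<open>\<psi>\<^sub>j\<^sub>,\<^sub>k\<close>, indexed by a disjoint sum:\<close>

definition cocycle_family :: "nat \<Rightarrow> (nat \<times> nat) + (nat \<times> nat) \<Rightarrow> 'a::field bimap" where
  "cocycle_family n = case_sum (\<lambda>(j, k). phi n j k) (\<lambda>(j, k). psi n j k)"

text \<open>An indexed family is a basis of a subspace \<open>W\<close>:\<close>

definition is_basis_of :: "('a::field \<Rightarrow> 'v::ab_group_add \<Rightarrow> 'v) \<Rightarrow> ('i \<Rightarrow> 'v) \<Rightarrow> 'i set \<Rightarrow> 'v set \<Rightarrow> bool" where
  "is_basis_of scale b I W \<longleftrightarrow>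
     inj_on b I \<and> \<not> module.dependent scale (b ` I) \<and> module.span scale (b ` I) = W"


section \<open>Basic facts\<close>

lemma vector_space_vscale: "vector_space (vscale :: 'a::field \<Rightarrow> 'a vec \<Rightarrow> 'a vec)"
  by unfold_locales (auto simp: vscale_def fun_eq_iff algebra_simps)

lemma vector_space_bscale: "vector_space (bscale :: 'a::field \<Rightarrow> 'a bimap \<Rightarrow> 'a bimap)"
  by unfold_locales (auto simp: bscale_def vscale_def fun_eq_iff algebra_simps)


lemma sum_bimap_apply: "(\<Sum>i\<in>I. f i) u v g = (\<Sum>i\<in>I. f i u v g)" for f :: "'i \<Rightarrow> 'a::field bimap"
  by (induction I rule: infinite_finite_induct) auto

lemma mem_whole_NF:
  "u \<in> whole (NF n) \<longleftrightarrow> (\<forall>g. u g \<noteq> 0 \<longrightarrow> g \<in> X ` {1..n} \<union> Y ` {1..n+1})"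
  for u :: "'a::field vec"
proof
  assume "u \<in> whole (NF n)"
  then obtain a b where ab: "u = a + b" "a \<in> NF n 0" "b \<in> NF n 1"
    unfolding whole_def by blast
  show "\<forall>g. u g \<noteq> 0 \<longrightarrow> g \<in> X ` {1..n} \<union> Y ` {1..n+1}"
  proof (intro allI impI)
    fix g assume "u g \<noteq> 0"
    then have "a g \<noteq> 0 \<or> b g \<noteq> 0" by (auto simp: ab(1))
    then show "g \<in> X ` {1..n} \<union> Y ` {1..n+1}"
      using ab(2,3) unfolding NF_def by fastforce
  qed
next
  assume u: "\<forall>g. u g \<noteq> 0 \<longrightarrow> g \<in> X ` {1..n} \<union> Y ` {1..n+1}"
  let ?a = "\<lambda>g. if g \<in> X ` {1..n} then u g else 0"
  let ?b = "\<lambda>g. if g \<in> X ` {1..n} then 0 else u g"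
  have "u = ?a + ?b" by (auto simp: fun_eq_iff)
  moreover have "?a \<in> NF n 0" by (auto simp: NF_def)
  moreover have "?b \<in> NF n 1" using u by (auto simp: NF_def)
  ultimately show "u \<in> whole (NF n)" unfolding whole_def by blast
qed

lemma NF_subset_whole: "u \<in> NF n a \<Longrightarrow> u \<in> whole (NF n)" for u :: "'a::field vec"
  unfolding mem_whole_NF by (auto simp: NF_def split: if_splits)

lemma NF_bracket_outside:
  "u \<notin> whole (NF n) \<or> v \<notin> whole (NF n) \<Longrightarrow> NF_bracket n u v = 0" for u :: "'a::field vec"
  by (rule ext) (auto simp: NF_bracket_def sum_bimap_apply elem_def)

lemma NF_bracket_X:
  assumes "u \<in> whole (NF n)" "v \<in> whole (NF n)"
  shows "NF_bracket n u v (X i) =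
    (if 1 \<le> i \<and> i \<le> n then u (Y i) * v (Y 1) else 0) +
    (if 2 \<le> i \<and> i \<le> n then u (X (i-1)) * v (X 1) else 0)"
proof -
  have 1: "(\<Sum>k=1..n. u (Y k) * v (Y 1) * (if X i = X k then 1 else 0)) =
      (if 1 \<le> i \<and> i \<le> n then u (Y i) * v (Y 1) else 0)"
    by (simp add: if_distrib sum.delta' cong: if_cong)
  have 2: "(\<Sum>k=1..<n. u (X k) * v (X 1) * (if X i = X (k+1) then 1 else 0)) =
      (if 2 \<le> i \<and> i \<le> n then u (X (i-1)) * v (X 1) else 0)"
  proof -
    have "(\<Sum>k=1..<n. u (X k) * v (X 1) * (if X i = X (k+1) then 1 else 0)) =
        (\<Sum>k=1..<n. if k = i - 1 then (if 2 \<le> i then u (X (i-1)) * v (X 1) else 0) else 0)"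
      by (rule sum.cong) auto
    also have "\<dots> = (if 2 \<le> i \<and> i \<le> n then u (X (i-1)) * v (X 1) else 0)"
      by (subst sum.delta) auto
    finally show ?thesis .
  qed
  have "NF_bracket n u v (X i) =
     (\<Sum>k=1..n. u (Y k) * v (Y 1) * (if X i = X k then 1 else 0)) +
     (\<Sum>k=1..<n. u (X k) * v (X 1) * (if X i = X (k+1) then 1 else 0))"
    using assms by (simp add: NF_bracket_def sum_bimap_apply elem_def vscale_def xv_def yv_def)
  then show ?thesis unfolding 1 2 .
qed

lemma NF_bracket_Y:
  assumes "u \<in> whole (NF n)" "v \<in> whole (NF n)"
  shows "NF_bracket n u v (Y i) =
    (if 2 \<le> i \<and> i \<le> n + 1 then 1/2 * u (X (i-1)) * v (Y 1) + u (Y (i-1)) * v (X 1) else 0)"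
proof -
  have *: "(\<Sum>k=1..n. c k * (if Y i = Y (k+1) then d else 0)) =
      (if 2 \<le> i \<and> i \<le> n + 1 then c (i-1) * d else 0)" for c and d :: 'a
  proof -
    have "(\<Sum>k=1..n. c k * (if Y i = Y (k+1) then d else 0)) =
        (\<Sum>k=1..n. if k = i - 1 then (if 2 \<le> i then c (i-1) * d else 0) else 0)"
      by (rule sum.cong) auto
    also have "\<dots> = (if 2 \<le> i \<and> i \<le> n + 1 then c (i-1) * d else 0)"
      by (subst sum.delta) auto
    finally show ?thesis .
  qed
  have "NF_bracket n u v (Y i) =
     (\<Sum>k=1..n. u (X k) * v (Y 1) * (if Y i = Y (k+1) then 1/2 else 0)) +
     (\<Sum>k=1..n. u (Y k) * v (X 1) * (if Y i = Y (k+1) then 1 else 0))"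
    using assms
    by (simp add: NF_bracket_def sum_bimap_apply elem_def vscale_def xv_def yv_def if_distrib
        cong: if_cong)
  then show ?thesis unfolding * by auto
qed

lemma NF_bracket_mem: "NF_bracket n u v \<in> whole (NF n)" for u :: "'a::field vec"
proof (cases "u \<in> whole (NF n) \<and> v \<in> whole (NF n)")
  case True
  then have uv: "u \<in> whole (NF n)" "v \<in> whole (NF n)" by auto
  show ?thesis unfolding mem_whole_NF
  proof (intro allI impI)
    fix g assume "NF_bracket n u v g \<noteq> 0"
    then show "g \<in> X ` {1..n} \<union> Y ` {1..n+1}"
      by (cases g) (auto simp: NF_bracket_X[OF uv] NF_bracket_Y[OF uv] split: if_splits)
  qed
next
  case False
  then show ?thesis by (auto simp: NF_bracket_outside mem_whole_NF)
qed

lemma whole_NF_add: "u \<in> whole (NF n) \<Longrightarrow> v \<in> whole (NF n) \<Longrightarrow> u + v \<in> whole (NF n)"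
  for u :: "'a::field vec"
  unfolding mem_whole_NF by (metis add_0 plus_fun_apply)

lemma whole_NF_scale: "u \<in> whole (NF n) \<Longrightarrow> vscale c u \<in> whole (NF n)" for u :: "'a::field vec"
  unfolding mem_whole_NF vscale_def by auto

lemma bilinear_on_NF_bracket: "bilinear_on vscale (whole (NF n)) (NF_bracket n :: 'a::field bimap)"
proof -
  have ext: "f = g" if "\<And>i. f (X i) = g (X i)" "\<And>i. f (Y i) = g (Y i)" for f g :: "'a vec"
    using that by (metis gen.exhaust ext)
  show ?thesis
    unfolding bilinear_on_def
    by (intro conjI allI ballI impI NF_bracket_mem NF_bracket_outside, assumption?)
      (rule ext; simp add: NF_bracket_X NF_bracket_Y whole_NF_add whole_NF_scale vscale_def[of _ "NF_bracket _ _ _"];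
       simp add: vscale_def algebra_simps)+
qed

lemma even_NF_bracket: "even_map (NF n) (NF_bracket n :: 'a::field bimap)"
  unfolding even_map_def
proof (intro allI ballI)
  fix a b and u v :: "'a vec"
  assume uv: "u \<in> NF n a" "v \<in> NF n b"
  note T = NF_subset_whole[OF uv(1)] NF_subset_whole[OF uv(2)]
  have 0: "w (Y i) = 0" if "w \<in> NF n 0" for w :: "'a vec" and i using that by (auto simp: NF_def)
  have 1: "w (X i) = 0" if "w \<in> NF n 1" for w :: "'a vec" and i using that by (auto simp: NF_def)
  show "NF_bracket n u v \<in> NF n (a + b)"
    unfolding NF_def mem_Collect_eq
  proof (intro allI impI)
    fix g assume g: "NF_bracket n u v g \<noteq> 0"
    show "g \<in> (if a + b = 0 then X ` {1..n} else Y ` {1..n + 1})"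
    proof (cases g)
      case (X i)
      then show ?thesis using g uv
        by (cases a; cases b) (auto simp: NF_bracket_X[OF T] 0 1 split: if_splits)
    next
      case (Y i)
      then show ?thesis using g uv
        by (cases a; cases b) (auto simp: NF_bracket_Y[OF T] 0 1 split: if_splits)
    qed
  qed
qed

lemma NF_leibniz_superalgebra:
  "leibniz_superalgebra vscale (NF n) (NF_bracket n :: 'a::field_char_0 bimap)"
proof (rule leibniz_superalgebra.intro[OF vector_space_vscale], unfold_locales)
  interpret vector_space "vscale :: 'a \<Rightarrow> 'a vec \<Rightarrow> 'a vec" by (rule vector_space_vscale)
  show "module.subspace vscale (NF n a :: 'a vec set)" for a
  proof (rule subspaceI)
    show "u + v \<in> NF n a" if "u \<in> NF n a" "v \<in> NF n a" for u v :: "'a vec"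
      using that unfolding NF_def mem_Collect_eq by (metis add_0 plus_fun_apply)
  qed (auto simp: NF_def vscale_def)
  show "NF n 0 \<inter> NF n 1 = ({0} :: 'a vec set)"
  proof (intro equalityI subsetI)
    fix u :: "'a vec" assume "u \<in> NF n 0 \<inter> NF n 1"
    then have "u g = 0" for g by (auto simp: NF_def)
    then show "u \<in> {0}" by (auto simp: fun_eq_iff)
  qed (auto simp: NF_def)
  show "bilinear_on vscale (whole (NF n)) (NF_bracket n :: 'a bimap)"
    by (rule bilinear_on_NF_bracket)
  show "even_map (NF n) (NF_bracket n :: 'a bimap)"
    by (rule even_NF_bracket)
  fix a b c and u v w :: "'a vec"
  assume uvw: "u \<in> NF n a" "v \<in> NF n b" "w \<in> NF n c"
  note T = uvw[THEN NF_subset_whole]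
  note B = NF_bracket_X NF_bracket_Y NF_bracket_mem
  have 0: "w (Y i) = 0" if "w \<in> NF n 0" for w :: "'a vec" and i using that by (auto simp: NF_def)
  have 1: "w (X i) = 0" if "w \<in> NF n 1" for w :: "'a vec" and i using that by (auto simp: NF_def)
  have V: "vscale d f g = d * f g" for d and f :: "'a vec" and g by (simp add: vscale_def)
  show "NF_bracket n u (NF_bracket n v w) = NF_bracket n (NF_bracket n u v) w -
      vscale (koszul_sign b c) (NF_bracket n (NF_bracket n u w) v)"
  proof
    fix g
    show "NF_bracket n u (NF_bracket n v w) g = (NF_bracket n (NF_bracket n u v) w -
      vscale (koszul_sign b c) (NF_bracket n (NF_bracket n u w) v)) g"
      using uvw T
      by (cases g; cases b; cases c)
        (auto simp: B V 0 1 koszul_sign_def algebra_simps)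
  qed
qed

lemma phi_printed_not_cocycle:
  assumes "n \<ge> 1"
  shows
    "elem n (Y (n+1)) (Y 1) (xv 1) +
     elem n (X n) (Y 1) (vscale (-1/2) (yv 1)) +
     elem n (Y n) (X 1) (- yv 1) +
     elem n (Y (n+1)) (X 1) (yv 2) +
     (\<Sum>i=1..n. elem n (X i) (Y (n+1)) (vscale (-1/2) (yv (i+1)))) +
     (\<Sum>i=1..n. elem n (Y i) (Y (n+1)) (- xv i))
     \<notin> (NF_cocycles n :: 'a::field_char_0 bimap set)" (is "?f \<notin> _")
proof
  assume f: "?f \<in> NF_cocycles n"
  have y: "(yv i :: 'a vec) \<in> NF n 1" if "1 \<le> i" "i \<le> n + 1" for i
    using that by (auto simp: NF_def yv_def split: if_splits)
  have T: "(yv i :: 'a vec) \<in> whole (NF n)" if "1 \<le> i" "i \<le> n + 1" for i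
    using y[OF that] by (rule NF_subset_whole)
  have Tx: "(xv i :: 'a vec) \<in> whole (NF n)" if "1 \<le> i" "i \<le> n" for i
    using that by (auto simp: mem_whole_NF xv_def split: if_splits)
  have ext: "f = g" if "\<And>i. f (X i) = g (X i)" "\<And>i. f (Y i) = g (Y i)" for f g :: "'a vec"
    using that by (metis gen.exhaust ext)
  have f1: "?f (yv (n+1)) (yv 1) = xv 1"
    using assms
    by (intro ext) (simp_all add: sum_bimap_apply elem_def T vscale_def, simp_all add: xv_def yv_def)
  have f2: "?f (yv 1) (yv (n+1)) = - xv 1"
  proof (rule ext)
    fix i
    have "(\<Sum>k=1..n. yv 1 (Y k) * yv (n+1) (Y (n+1)) * - xv k (X i)) =
        (\<Sum>k=1..n. if k = 1 then - (xv 1 (X i) :: 'a) else 0)"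
      by (rule sum.cong) (auto simp: yv_def)
    also have "\<dots> = - xv 1 (X i)" using assms by simp
    finally show "?f (yv 1) (yv (n+1)) (X i) = (- xv 1) (X i)"
      using assms
      by (simp add: sum_bimap_apply elem_def T vscale_def)
        (simp add: yv_def xv_def)
  next
    fix i
    show "?f (yv 1) (yv (n+1)) (Y i) = (- xv 1) (Y i)"
      using assms
      by (simp add: sum_bimap_apply elem_def T vscale_def)
        (simp add: yv_def xv_def)
  qed
  have f3: "?f (yv 1) (yv 1) = 0"
    using assms
    by (intro ext) (simp_all add: sum_bimap_apply elem_def T vscale_def, simp_all add: xv_def yv_def)
  have f4: "?f (xv 1) (yv (n+1)) (Y 2) = -1/2"
  proof -
    have "(\<Sum>k=1..n. xv 1 (X k) * yv (n+1) (Y (n+1)) * (-1/2 * yv (k+1) (Y 2))) =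
        (\<Sum>k=1..n. if k = 1 then -1/2 else (0::'a))"
      by (rule sum.cong) (auto simp: xv_def yv_def)
    also have "\<dots> = -1/2" using assms by simp
    finally show ?thesis
      using assms
      by (simp add: sum_bimap_apply elem_def T Tx vscale_def) (simp add: yv_def xv_def)
  qed
  have z: "(0 :: 'a vec) \<in> whole (NF n)" by (simp add: mem_whole_NF)
  have f0: "?f (yv 1) 0 = 0" "?f 0 (yv 1) = 0"
    by (rule HOL.ext, simp add: sum_bimap_apply elem_def vscale_def T z)+
  have b1: "NF_bracket n (yv (n+1)) (yv 1) = (0 :: 'a vec)"
    using assms by (intro ext) (simp_all add: NF_bracket_X NF_bracket_Y T, simp_all add: xv_def yv_def)
  have b2: "NF_bracket n (yv 1) (yv (n+1)) = (0 :: 'a vec)"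
    using assms by (intro ext) (simp_all add: NF_bracket_X NF_bracket_Y T, simp_all add: xv_def yv_def)
  have b3: "NF_bracket n (yv 1) (yv 1) = (xv 1 :: 'a vec)"
    using assms by (intro ext) (simp_all add: NF_bracket_X NF_bracket_Y T, simp_all add: xv_def yv_def)
  have b4: "NF_bracket n (yv 1) (xv 1) (Y 2) = (1 :: 'a)"
    using assms by (simp add: NF_bracket_Y T Tx) (simp add: xv_def yv_def)
  have mx: "(- xv 1 :: 'a vec) \<in> whole (NF n)"
    using assms by (auto simp: mem_whole_NF xv_def split: if_splits)
  have b5: "NF_bracket n (- xv 1) (yv 1) (Y 2) = (-1/2 :: 'a)"
    using assms by (subst NF_bracket_Y[OF mx T]) (auto simp: xv_def yv_def)
  have b6: "NF_bracket n 0 (yv (n+1)) (Y 2) = (0 :: 'a)"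
    using assms by (simp add: NF_bracket_Y T z)
  have cocycle: "NF_bracket n u (F v w) - NF_bracket n (F u v) w
      + vscale (koszul_sign 1 1) (NF_bracket n (F u w) v)
      + F u (NF_bracket n v w) - F (NF_bracket n u v) w
      + vscale (koszul_sign 1 1) (F (NF_bracket n u w) v) = 0"
    if "F \<in> NF_cocycles n" "u \<in> NF n 1" "v \<in> NF n 1" "w \<in> NF n 1"
    for F :: "'a bimap" and u v w
    using that unfolding even_2_cocycles_def by blast
  have y1: "(yv 1 :: 'a vec) \<in> NF n 1" and yn: "(yv (n+1) :: 'a vec) \<in> NF n 1"
    using y by auto
  define F where "F = ?f"
  note F = f1[folded F_def] f2[folded F_def] f3[folded F_def] f0[folded F_def]
  have "(1 :: 'a) + 1/2 + 1/2 = 0"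
    using fun_cong[OF cocycle[OF f[folded F_def] y1 yn y1], of "Y 2"]
    unfolding b1 b2 b3 F
    by (simp only: plus_fun_apply minus_apply zero_fun_apply vscale_def f4[folded F_def] b4 b5 b6)
      (simp add: koszul_sign_def)
  then show False by simp
qed

end

theory Submission
  imports Defs
begin

text \<open>
  Write \<open>T u = [u, y\<^sub>1]\<close>, and let \<open>v\<^sub>1, v\<^sub>2\<close> be the coefficients of \<open>v\<close> at \<open>y\<^sub>1, x\<^sub>1\<close>.  The algebra is
  generated by \<open>y\<^sub>1\<close>, and \<open>[u, v] = v\<^sub>1 T u + 2 v\<^sub>2 T T u\<close>.  The cocycle identity with \<open>y\<^sub>1\<close> as last
  argument expresses \<open>f(u, T v)\<close> through values \<open>f(\<cdot>, v)\<close> and \<open>f(\<cdot>, y\<^sub>1)\<close>, so a cocycle \<open>f\<close> is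
  determined by the odd linear map \<open>D = f(\<cdot>, y\<^sub>1)\<close>; solving the recursion gives
  \<open>f(u, v) = v\<^sub>1 D u + 2 v\<^sub>2 (D T u + T D u) - \<alpha>(v) T u - 2 \<beta>(v) T T u\<close>
  with functionals satisfying \<open>\<alpha>(T v) = (D v)\<^sub>1\<close> and \<open>\<beta>(T v) = (D v)\<^sub>2 + \<alpha>(v)\<close>.  Conversely each such
  \<open>f\<close> is a cocycle, and every \<open>\<phi>\<^sub>j\<^sub>,\<^sub>k\<close> and \<open>\<psi>\<^sub>j\<^sub>,\<^sub>k\<close> has this form with \<open>D\<close> (essentially) a matrix unit.
  Since \<open>T y\<^sub>n\<^sub>+\<^sub>1 = 0\<close>, the end of the recursion imposes exactly one linear condition on \<open>D\<close>, which is
  why the matrix unit \<open>x\<^sub>n \<mapsto> y\<^sub>1\<close> is missing from the family.  The matrix entries of \<open>D\<close> other than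
  this one are coordinates dual to the family, and they separate cocycles.
\<close>

section \<open>The operator T of right multiplication by y_1, and the grading in coordinates\<close>

definition shift :: "nat \<Rightarrow> 'a::field vec \<Rightarrow> 'a vec" where
  "shift n u = case_gen (\<lambda>i. if 1 \<le> i \<and> i \<le> n then u (Y i) else 0)
     (\<lambda>i. if 2 \<le> i \<and> i \<le> n + 1 then u (X (i - 1)) / 2 else 0)"

lemma shift_X [simp]: "shift n u (X i) = (if 1 \<le> i \<and> i \<le> n then u (Y i) else 0)"
  and shift_Y [simp]: "shift n u (Y i) = (if 2 \<le> i \<and> i \<le> n + 1 then u (X (i - 1)) / 2 else 0)"
  by (simp_all add: shift_def)

lemma vec_eqI:
  fixes u v :: "'a::field vec"
  assumes "\<And>i. u (X i) = v (X i)" "\<And>i. u (Y i) = v (Y i)"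
  shows "u = v"
  using assms by (metis gen.exhaust ext)

lemma vscale_apply [simp]: "vscale c u g = c * u g"
  by (simp add: vscale_def)

lemma shift_add: "shift n (u + v) = shift n u + shift n v"
  by (rule vec_eqI) (auto simp: add_divide_distrib)

lemma shift_scale: "shift n (vscale c u) = vscale c (shift n u)"
  by (rule vec_eqI) auto

lemma all_gen: "(\<forall>g. P g) \<longleftrightarrow> (\<forall>i. P (X i)) \<and> (\<forall>i. P (Y i))"
  by (metis gen.exhaust)

lemma NF_0_iff: "u \<in> NF n 0 \<longleftrightarrow> (\<forall>i. u (Y i) = 0) \<and> (\<forall>i. i \<notin> {1..n} \<longrightarrow> u (X i) = 0)"
  unfolding NF_def mem_Collect_eq all_gen by (auto simp: image_iff)

lemma NF_1_iff: "u \<in> NF n 1 \<longleftrightarrow> (\<forall>i. u (X i) = 0) \<and> (\<forall>i. i \<notin> {1..n+1} \<longrightarrow> u (Y i) = 0)"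
  unfolding NF_def mem_Collect_eq all_gen by (auto simp: image_iff)

lemma mem_whole_NF_iff:
  "u \<in> whole (NF n) \<longleftrightarrow>
    (\<forall>i. i \<notin> {1..n} \<longrightarrow> u (X i) = 0) \<and> (\<forall>i. i \<notin> {1..n+1} \<longrightarrow> u (Y i) = 0)"
  unfolding mem_whole_NF all_gen by (auto simp: image_iff)

lemma NF_add: "u \<in> NF n a \<Longrightarrow> v \<in> NF n a \<Longrightarrow> u + v \<in> NF n a"
  and NF_scale: "u \<in> NF n a \<Longrightarrow> vscale c u \<in> NF n a"
  and NF_zero: "0 \<in> NF n a"
  by (cases a; auto simp: NF_0_iff NF_1_iff)+

lemma NF_diff: "u \<in> NF n a \<Longrightarrow> v \<in> NF n a \<Longrightarrow> u - v \<in> NF n a"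
  by (cases a; auto simp: NF_0_iff NF_1_iff)

lemma NF_shift: "u \<in> NF n a \<Longrightarrow> shift n u \<in> NF n (a + 1)"
  by (cases a) (auto simp: NF_0_iff NF_1_iff)

lemma whole_shift: "shift n u \<in> whole (NF n)"
  by (auto simp: mem_whole_NF_iff)

text \<open>Since x_1 = [y_1, y_1], the Leibniz identity forces right multiplication by x_1 to be 2
  T T; products with any other basis vector on the right vanish.\<close>

lemma NF_bracket_eq:
  fixes u v :: "'a::field_char_0 vec"
  assumes "u \<in> whole (NF n)" "v \<in> whole (NF n)"
  shows "NF_bracket n u v = vscale (v (Y 1)) (shift n u) + vscale (2 * v (X 1)) (shift n (shift n u))"
  by (rule vec_eqI) (auto simp: NF_bracket_X[OF assms] NF_bracket_Y[OF assms])

subsection \<open>Cocycles with prescribed values on \<open>(\<cdot>, y\<^sub>1)\<close>\<close>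

text \<open>At u = y_{n+1}, where T u = 0, the assumption \<open>\<beta>_shift\<close> reads (D
  y_{n+1})_2 + \<alpha>(y_{n+1}) = 0, and \<alpha>(y_{n+1}) = 2 (D x_n)_1 by
  \<open>\<alpha>_shift\<close>: this is the one constraint on D. The value \<alpha>(y_1) stays
  free, because y_1 is not in the image of T; changing it changes \<beta>(x_1) by the same
  amount.\<close>

locale cocycle_data =
  fixes n :: nat and D :: "'a::field_char_0 vec \<Rightarrow> 'a vec" and \<alpha> \<beta> :: "'a vec \<Rightarrow> 'a"
  assumes n_pos: "n \<ge> 1"
    and D_add: "D (u + v) = D u + D v" and D_scale: "D (vscale c u) = vscale c (D u)"
    and D_odd: "u \<in> NF n a \<Longrightarrow> D u \<in> NF n (a + 1)"
    and \<alpha>_add: "\<alpha> (u + v) = \<alpha> u + \<alpha> v" and \<alpha>_scale: "\<alpha> (vscale c u) = c * \<alpha> u"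
    and \<beta>_add: "\<beta> (u + v) = \<beta> u + \<beta> v" and \<beta>_scale: "\<beta> (vscale c u) = c * \<beta> u"
    and \<alpha>_even: "u \<in> NF n 0 \<Longrightarrow> \<alpha> u = 0" and \<beta>_odd: "u \<in> NF n 1 \<Longrightarrow> \<beta> u = 0"
    and \<alpha>_shift: "\<alpha> (shift n u) = D u (Y 1)"
    and \<beta>_shift: "\<beta> (shift n u) = D u (X 1) + \<alpha> u"
begin

text \<open>This is the first-order variation of v_1 T u + 2 v_2 T T u when T moves in direction D
  and the functionals v_1, v_2 move in directions -\<alpha>, -\<beta>.\<close>

definition total_map :: "'a bimap" where
  "total_map u v = vscale (v (Y 1)) (D u) + vscale (2 * v (X 1)) (D (shift n u) + shift n (D u))
     - vscale (\<alpha> v) (shift n u) - vscale (2 * \<beta> v) (shift n (shift n u))"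

text \<open>The cut-off follows the convention of \<open>bilinear_on\<close>. Keeping it out of
  \<open>total_map\<close> lets the algebra there run without membership conditions.\<close>

definition deform :: "'a bimap" where
  "deform u v = (if u \<in> whole (NF n) \<and> v \<in> whole (NF n) then total_map u v else 0)"

lemma total_map_mem:
  assumes u: "u \<in> NF n a" and v: "v \<in> NF n b"
  shows "total_map u v \<in> NF n (a + b)"
proof -
  have a: "a + (1 + 1) = a" by (cases a) simp_all
  have T: "D u \<in> NF n (a + 1)" "shift n u \<in> NF n (a + 1)"
    by (rule D_odd[OF u], rule NF_shift[OF u])
  have TT: "D (shift n u) \<in> NF n a" "shift n (D u) \<in> NF n a" "shift n (shift n u) \<in> NF n a"
    using D_odd[OF T(2)] NF_shift[OF T(1)] NF_shift[OF T(2)] by (simp_all only: add.assoc a)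
  show ?thesis
  proof (cases b)
    case zero
    then have "v (Y 1) = 0" "\<alpha> v = 0" using v \<alpha>_even by (auto simp: NF_0_iff)
    then have "total_map u v = vscale (2 * v (X 1)) (D (shift n u) + shift n (D u))
        - vscale (2 * \<beta> v) (shift n (shift n u))"
      by (simp add: total_map_def fun_eq_iff)
    with TT zero show ?thesis by (simp only: NF_add NF_diff NF_scale add_0_right)
  next
    case one
    then have "v (X 1) = 0" "\<beta> v = 0" using v \<beta>_odd by (auto simp: NF_1_iff)
    then have "total_map u v = vscale (v (Y 1)) (D u) - vscale (\<alpha> v) (shift n u)"
      by (simp add: total_map_def fun_eq_iff)
    with T one show ?thesis by (simp only: NF_diff NF_scale)
  qed
qed

lemma total_map_linear:
  "total_map (u + u') v = total_map u v + total_map u' v"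
  "total_map u (v + v') = total_map u v + total_map u v'"
  "total_map (vscale c u) v = vscale c (total_map u v)"
  "total_map u (vscale c v) = vscale c (total_map u v)"
  by (rule ext; simp add: total_map_def D_add D_scale \<alpha>_add \<alpha>_scale \<beta>_add \<beta>_scale
      shift_add shift_scale algebra_simps)+

lemma whole_total_map:
  assumes "u \<in> whole (NF n)" "v \<in> whole (NF n)"
  shows "total_map u v \<in> whole (NF n)"
proof -
  obtain u0 u1 v0 v1 where "u = u0 + u1" "v = v0 + v1" "u0 \<in> NF n 0" "v0 \<in> NF n 0"
      "u1 \<in> NF n 1" "v1 \<in> NF n 1"
    using assms unfolding whole_def by blast
  then show ?thesis
    by (simp add: total_map_linear) (intro whole_NF_add; meson NF_subset_whole total_map_mem)
qed

text \<open>A bracket a(v) T u + 2 b(v) T T u, with a zero on even and b zero on odd vectors,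
  satisfies the Leibniz identity as soon as a(T v) = 0 and b(T v) = a(v). Linearizing these two
  equations along the variation gives \<open>\<alpha>_shift\<close> and
  \<open>\<beta>_shift\<close>; linearizing the Leibniz identity gives the cocycle identity.\<close>

lemma total_map_cocycle:
  fixes v w :: "'a vec"
  defines "br \<equiv> \<lambda>u v :: 'a vec. vscale (v (Y 1)) (shift n u) + vscale (2 * v (X 1)) (shift n (shift n u))"
  assumes v: "v \<in> NF n b" and w: "w \<in> NF n c"
  shows "br u (total_map v w) - br (total_map u v) w
      + vscale (koszul_sign b c) (br (total_map u w) v)
      + total_map u (br v w) - total_map (br u v) w
      + vscale (koszul_sign b c) (total_map (br u w) v) = 0"
proof -
  have diff: "shift n (p - q) = shift n p - shift n q" "D (p - q) = D p - D q" for p q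
    using shift_add[of n "p - q" q] D_add[of "p - q" q] by simp_all
  \<comment> \<open>On a homogeneous argument only one of the pairs (v_1, \<alpha>) and (v_2,
    \<beta>) can be nonzero, which leaves four parity cases.\<close>
  have b: "b = 0 \<and> v (Y 1) = 0 \<and> \<alpha> v = 0 \<or> b = 1 \<and> v (X 1) = 0 \<and> \<beta> v = 0"
    using v \<alpha>_even \<beta>_odd by (cases b) (auto simp: NF_0_iff NF_1_iff)
  have c: "c = 0 \<and> w (Y 1) = 0 \<and> \<alpha> w = 0 \<or> c = 1 \<and> w (X 1) = 0 \<and> \<beta> w = 0"
    using w \<alpha>_even \<beta>_odd by (cases c) (auto simp: NF_0_iff NF_1_iff)
  show ?thesis
    using n_pos b c
    by (intro ext; elim disjE; simp add: br_def total_map_def koszul_sign_def diff D_add D_scale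
        \<alpha>_add \<alpha>_scale \<beta>_add \<beta>_scale \<alpha>_shift \<beta>_shift shift_add shift_scale; simp add: algebra_simps)
qed

lemma deform_cocycle: "deform \<in> NF_cocycles n"
proof -
  have bil: "bilinear_on vscale (whole (NF n)) deform"
    unfolding bilinear_on_def
    by (auto simp: deform_def whole_total_map whole_NF_add whole_NF_scale total_map_linear)
  have even: "even_map (NF n) deform"
    unfolding even_map_def using total_map_mem by (auto simp: deform_def NF_subset_whole)
  have "NF_bracket n u (deform v w) - NF_bracket n (deform u v) w
      + vscale (koszul_sign b c) (NF_bracket n (deform u w) v)
      + deform u (NF_bracket n v w) - deform (NF_bracket n u v) w
      + vscale (koszul_sign b c) (deform (NF_bracket n u w) v) = 0"
    if "u \<in> NF n a" "v \<in> NF n b" "w \<in> NF n c" for a b c u v w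
  proof -
    note W = that[THEN NF_subset_whole]
    show ?thesis
      using total_map_cocycle[OF that(2,3), of u] W
      by (simp add: deform_def NF_bracket_mem whole_total_map)
        (simp add: NF_bracket_eq whole_total_map)
  qed
  then show ?thesis
    unfolding even_2_cocycles_def using bil even by blast
qed

end

subsection \<open>The maps \<open>\<phi>\<^sub>j\<^sub>,\<^sub>k\<close> and \<open>\<psi>\<^sub>j\<^sub>,\<^sub>k\<close>\<close>

lemma elem_apply:
  "u \<in> whole (NF n) \<Longrightarrow> v \<in> whole (NF n) \<Longrightarrow> elem n g h w u v = vscale (u g * v h) w"
  by (simp add: elem_def)

lemma sum_elem_outside:
  "u \<notin> whole (NF n) \<or> v \<notin> whole (NF n) \<Longrightarrow> (\<Sum>i\<in>I. elem n (G i) h (w i)) u v = 0"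
  by (rule ext) (auto simp: sum_bimap_apply elem_def)

lemma sum_elem_uminus:
  "(\<Sum>i\<in>I. elem n (G i) h (- w i)) u v = - (\<Sum>i\<in>I. elem n (G i) h (w i)) u v"
  by (cases "u \<in> whole (NF n) \<and> v \<in> whole (NF n)")
    (auto simp: fun_eq_iff sum_bimap_apply elem_def sum_negf)

lemma sum_elem_vscale:
  "(\<Sum>i\<in>I. elem n (G i) h (vscale c (w i))) u v = vscale c ((\<Sum>i\<in>I. elem n (G i) h (w i)) u v)"
  by (cases "u \<in> whole (NF n) \<and> v \<in> whole (NF n)")
    (auto simp: fun_eq_iff sum_bimap_apply elem_def sum_distrib_left algebra_simps)

lemma sum_mult_delta:
  fixes f :: "nat \<Rightarrow> 'a::field"
  assumes "finite I"
  shows "(\<Sum>i\<in>I. f i * (if l = i then 1 else 0)) = (if l \<in> I then f l else 0)"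
    and "(\<Sum>i\<in>I. f i * (if l = Suc i then 1 else 0)) = (if 1 \<le> l \<and> l - 1 \<in> I then f (l - 1) else 0)"
proof -
  show *: "(\<Sum>i\<in>I. f i * (if l = i then 1 else 0)) = (if l \<in> I then f l else 0)" for l
    using assms by (simp add: if_distrib sum.delta' cong: if_cong)
  show "(\<Sum>i\<in>I. f i * (if l = Suc i then 1 else 0)) = (if 1 \<le> l \<and> l - 1 \<in> I then f (l - 1) else 0)"
    using *[of "l - 1"] by (cases l) simp_all
qed

lemma sum_elem_basis:
  assumes "finite I" "u \<in> whole (NF n)" "v \<in> whole (NF n)"
  shows "(\<Sum>i\<in>I. elem n (G i) h (xv i)) u v (X l) = (if l \<in> I then u (G l) * v h else 0)"
    "(\<Sum>i\<in>I. elem n (G i) h (xv i)) u v (Y l) = 0"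
    "(\<Sum>i\<in>I. elem n (G i) h (xv (Suc i))) u v (X l) =
      (if 1 \<le> l \<and> l - 1 \<in> I then u (G (l - 1)) * v h else 0)"
    "(\<Sum>i\<in>I. elem n (G i) h (xv (Suc i))) u v (Y l) = 0"
    "(\<Sum>i\<in>I. elem n (G i) h (yv (Suc i))) u v (Y l) =
      (if 1 \<le> l \<and> l - 1 \<in> I then u (G (l - 1)) * v h else 0)"
    "(\<Sum>i\<in>I. elem n (G i) h (yv (Suc i))) u v (X l) = 0"
  using assms sum_mult_delta[of I "\<lambda>i. u (G i) * v h" l]
  by (simp_all add: sum_bimap_apply elem_def xv_def yv_def)

text \<open>The matrix unit y_j to x_k. For (j, k) = (n+1, 1) it violates the constraint on D, and
  the entry -1/2 from x_n to y_1 repairs this.\<close>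

definition phi_D :: "nat \<Rightarrow> nat \<Rightarrow> nat \<Rightarrow> 'a::field vec \<Rightarrow> 'a vec" where
  "phi_D n j k u = vscale (u (Y j)) (xv k) +
     vscale (if j = n + 1 \<and> k = 1 then - u (X n) / 2 else 0) (yv 1)"

text \<open>Obtained by solving the recursions from \<alpha>(y_1) = 0: the corrected entry gives
  \<alpha>(y_{n+1}) = 2 \<alpha>(T x_n) = -1, and for j \<le> n, k = 1 one gets \<beta>(x_j) =
  \<beta>(T y_j) = 1.\<close>

definition phi_\<alpha> :: "nat \<Rightarrow> nat \<Rightarrow> nat \<Rightarrow> 'a::field vec \<Rightarrow> 'a" where
  "phi_\<alpha> n j k v = (if j = n + 1 \<and> k = 1 then - v (Y (n + 1)) else 0)"

definition phi_\<beta> :: "nat \<Rightarrow> nat \<Rightarrow> nat \<Rightarrow> 'a::field vec \<Rightarrow> 'a" where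
  "phi_\<beta> n j k v = (if j \<le> n \<and> k = 1 then v (X j) else 0)"

definition psi_D :: "nat \<Rightarrow> nat \<Rightarrow> 'a::field vec \<Rightarrow> 'a vec" where
  "psi_D j k u = vscale (u (X j)) (yv k)"

text \<open>For k = 1, \<alpha>(T x_j) = 1 and T x_j = y_{j+1}/2 give the factor 2, which
  \<open>\<beta>_shift\<close> at y_{j+1} then passes on to \<beta>(x_{j+1}).\<close>

definition psi_\<alpha> :: "nat \<Rightarrow> nat \<Rightarrow> 'a::field vec \<Rightarrow> 'a" where
  "psi_\<alpha> j k v = (if k = 1 then 2 * v (Y (j + 1)) else 0)"

definition psi_\<beta> :: "nat \<Rightarrow> nat \<Rightarrow> 'a::field vec \<Rightarrow> 'a" where
  "psi_\<beta> j k v = (if k = 1 then 2 * v (X (j + 1)) else 0)"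

lemma phi_data:
  assumes "n \<ge> 1" "(j, k) \<in> phi_index n"
  shows "cocycle_data n (phi_D n j k :: 'a::field_char_0 vec \<Rightarrow> _) (phi_\<alpha> n j k) (phi_\<beta> n j k)"
proof
  have jk: "1 \<le> j" "j \<le> n + 1" "1 \<le> k" "k \<le> n" using assms by (auto simp: phi_index_def)
  fix u v :: "'a vec" and c :: 'a and a :: bit
  show "n \<ge> 1" by fact
  show "phi_D n j k (u + v) = phi_D n j k u + phi_D n j k v"
    by (simp add: phi_D_def fun_eq_iff field_simps)
  show "phi_D n j k (vscale c u) = vscale c (phi_D n j k u)"
    by (simp add: phi_D_def fun_eq_iff field_simps)
  show "phi_D n j k u \<in> NF n (a + 1)" if "u \<in> NF n a"
    using jk that
    by (cases a) (auto simp: NF_0_iff NF_1_iff phi_D_def xv_def yv_def)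
  show "phi_\<alpha> n j k (u + v) = phi_\<alpha> n j k u + phi_\<alpha> n j k v"
    "phi_\<alpha> n j k (vscale c u) = c * phi_\<alpha> n j k u"
    "phi_\<beta> n j k (u + v) = phi_\<beta> n j k u + phi_\<beta> n j k v"
    "phi_\<beta> n j k (vscale c u) = c * phi_\<beta> n j k u"
    by (simp_all add: phi_\<alpha>_def phi_\<beta>_def)
  show "phi_\<alpha> n j k u = 0" if "u \<in> NF n 0"
    using that by (simp add: phi_\<alpha>_def NF_0_iff)
  show "phi_\<beta> n j k u = 0" if "u \<in> NF n 1"
    using that by (simp add: phi_\<beta>_def NF_1_iff)
  show "phi_\<alpha> n j k (shift n u) = phi_D n j k u (Y 1)"
    using assms(1) by (simp add: phi_\<alpha>_def phi_D_def xv_def yv_def)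
  show "phi_\<beta> n j k (shift n u) = phi_D n j k u (X 1) + phi_\<alpha> n j k u"
    using jk by (auto simp: phi_\<alpha>_def phi_\<beta>_def phi_D_def xv_def yv_def)
qed

lemma psi_data:
  assumes "(j, k) \<in> psi_index n"
  shows "cocycle_data n (psi_D j k :: 'a::field_char_0 vec \<Rightarrow> _) (psi_\<alpha> j k) (psi_\<beta> j k)"
proof
  have jk: "1 \<le> j" "j \<le> n" "1 \<le> k" "k \<le> n + 1" "k = 1 \<Longrightarrow> j < n"
    using assms by (auto simp: psi_index_def)
  fix u v :: "'a vec" and c :: 'a and a :: bit
  show "n \<ge> 1" using jk by simp
  show "psi_D j k (u + v) = psi_D j k u + psi_D j k v"
    by (simp add: psi_D_def fun_eq_iff field_simps)
  show "psi_D j k (vscale c u) = vscale c (psi_D j k u)"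
    by (simp add: psi_D_def fun_eq_iff field_simps)
  show "psi_D j k u \<in> NF n (a + 1)" if "u \<in> NF n a"
    using jk that
    by (cases a) (auto simp: NF_0_iff NF_1_iff psi_D_def xv_def yv_def)
  show "psi_\<alpha> j k (u + v) = psi_\<alpha> j k u + psi_\<alpha> j k v"
    "psi_\<alpha> j k (vscale c u) = c * psi_\<alpha> j k u"
    "psi_\<beta> j k (u + v) = psi_\<beta> j k u + psi_\<beta> j k v"
    "psi_\<beta> j k (vscale c u) = c * psi_\<beta> j k u"
    by (simp_all add: psi_\<alpha>_def psi_\<beta>_def algebra_simps)
  show "psi_\<alpha> j k u = 0" if "u \<in> NF n 0"
    using that by (simp add: psi_\<alpha>_def NF_0_iff)
  show "psi_\<beta> j k u = 0" if "u \<in> NF n 1"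
    using that by (simp add: psi_\<beta>_def NF_1_iff)
  show "psi_\<alpha> j k (shift n u) = psi_D j k u (Y 1)"
    using jk by (simp add: psi_\<alpha>_def psi_D_def xv_def yv_def)
  \<comment> \<open>For k = 1 this needs T y_{j+1} = x_{j+1}, hence j < n: here the exclusion of (n,
    1) enters.\<close>
  show "psi_\<beta> j k (shift n u) = psi_D j k u (X 1) + psi_\<alpha> j k u"
    using jk by (auto simp: psi_\<alpha>_def psi_\<beta>_def psi_D_def xv_def yv_def)
qed

section \<open>Matching the listed maps with the general form of a cocycle\<close>

lemma shift_basis:
  "1 \<le> k \<Longrightarrow> k \<le> n \<Longrightarrow> shift n (xv k :: 'a::field vec) = vscale (1 / 2) (yv (k + 1))"
  "1 \<le> k \<Longrightarrow> k \<le> n \<Longrightarrow> shift n (yv k :: 'a::field vec) = xv k"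
  "shift n (yv (Suc n) :: 'a::field vec) = 0"
  by (rule vec_eqI; auto simp: xv_def yv_def)+

text \<open>T sends y_i to x_i and x_i to y_{i+1}/2, so the sums over X and over Y are its
  restrictions to the even and the odd part, and likewise for T T. Solving for one part makes the
  remaining sums cancel in \<open>phi_total\<close> and \<open>psi_total\<close>. The last equation
  serves the sum in \<open>phi n 1 1\<close> that starts at 2.\<close>

lemma sum_elem_shift:
  fixes u v :: "'a::field_char_0 vec"
  assumes "u \<in> whole (NF n)" "v \<in> whole (NF n)"
  shows "(\<Sum>i=1..n. elem n (X i) h (yv (i + 1))) u v
      = vscale (2 * v h) (shift n u) - vscale 2 ((\<Sum>i=1..n. elem n (Y i) h (xv i)) u v)"
    and "(\<Sum>i=1..<n. elem n (X i) h (xv (i + 1))) u v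
      = vscale (2 * v h) (shift n (shift n u)) - (\<Sum>i=1..n. elem n (Y i) h (yv (i + 1))) u v"
    and "n \<ge> 1 \<Longrightarrow> (\<Sum>i=2..n. elem n (Y i) h (yv (i + 1))) u v
      = (\<Sum>i=1..n. elem n (Y i) h (yv (i + 1))) u v - vscale (u (Y 1) * v h) (yv 2)"
proof -
  show "(\<Sum>i=1..n. elem n (X i) h (yv (i + 1))) u v
      = vscale (2 * v h) (shift n u) - vscale 2 ((\<Sum>i=1..n. elem n (Y i) h (xv i)) u v)"
    by (rule vec_eqI) (auto simp: sum_elem_basis assms)
  show "(\<Sum>i=1..<n. elem n (X i) h (xv (i + 1))) u v
      = vscale (2 * v h) (shift n (shift n u)) - (\<Sum>i=1..n. elem n (Y i) h (yv (i + 1))) u v"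
    by (rule vec_eqI) (auto simp: sum_elem_basis assms)
  have yv2: "yv 2 (Y l) = (if l = 2 then 1 else (0::'a))" "yv 2 (X l) = (0::'a)" for l
    by (auto simp: yv_def)
  show "(\<Sum>i=2..n. elem n (Y i) h (yv (i + 1))) u v
      = (\<Sum>i=1..n. elem n (Y i) h (yv (i + 1))) u v - vscale (u (Y 1) * v h) (yv 2)" if "n \<ge> 1"
  proof (rule vec_eqI)
    show "(\<Sum>i=2..n. elem n (Y i) h (yv (i + 1))) u v (Y l)
      = ((\<Sum>i=1..n. elem n (Y i) h (yv (i + 1))) u v - vscale (u (Y 1) * v h) (yv 2)) (Y l)" for l
      using that yv2 by (cases "l = 2") (auto simp: sum_elem_basis assms)
  qed (simp add: sum_elem_basis assms yv2)
qed

lemma phi_total: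
  fixes u v :: "'a::field_char_0 vec"
  assumes n: "n \<ge> 1" and jk: "(j, k) \<in> phi_index n" and uv: "u \<in> whole (NF n)" "v \<in> whole (NF n)"
  shows "phi n j k u v = cocycle_data.total_map n (phi_D n j k) (phi_\<alpha> n j k) (phi_\<beta> n j k) u v"
proof -
  note E = elem_apply[OF uv]
  note S = sum_elem_uminus sum_elem_vscale
  note R = sum_elem_shift[OF uv, simplified]
  note T = cocycle_data.total_map_def[OF phi_data[OF n jk]]
  note D = phi_D_def phi_\<alpha>_def phi_\<beta>_def shift_add shift_scale
  have DT: "phi_D n j k (shift n u) = vscale (if 2 \<le> j then u (X (j - 1)) / 2 else 0) (xv k)
      + vscale (if j = n + 1 \<and> k = 1 then - u (Y n) / 2 else 0) (yv 1)"
    using n jk by (auto simp: phi_D_def phi_index_def)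
  have TD: "shift n (phi_D n j k u) = vscale (u (Y j) / 2) (yv (k + 1))
      + vscale (if j = n + 1 \<and> k = 1 then - u (X n) / 2 else 0) (xv 1)"
    using n jk by (auto simp: phi_D_def phi_index_def shift_add shift_scale shift_basis)
  consider "k = 1" "j = 1" | "k = 1" "2 \<le> j" "j \<le> n" | "k = 1" "j = n + 1"
    | "2 \<le> k" "j = 1" | "2 \<le> k" "2 \<le> j"
    using jk by (force simp: phi_index_def)
  then show ?thesis
  proof cases
    case 1
    then show ?thesis
      using n unfolding T DT TD by (simp add: phi_def S E D R; simp add: fun_eq_iff numeral_2_eq_2 algebra_simps)
  next
    case 2
    then show ?thesis
      using n unfolding T DT TD by (simp add: phi_def S E D R; simp add: fun_eq_iff numeral_2_eq_2 algebra_simps)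
  next
    case 3
    then show ?thesis
      using n unfolding T DT TD by (simp add: phi_def S E D R; simp add: fun_eq_iff numeral_2_eq_2 algebra_simps)
  next
    case 4
    then show ?thesis
      unfolding T DT TD by (auto simp: phi_def S E D fun_eq_iff field_simps)
  next
    case 5
    then show ?thesis
      unfolding T DT TD by (auto simp: phi_def S E D fun_eq_iff field_simps)
  qed
qed

lemma psi_total:
  fixes u v :: "'a::field_char_0 vec"
  assumes jk: "(j, k) \<in> psi_index n" and uv: "u \<in> whole (NF n)" "v \<in> whole (NF n)"
  shows "psi n j k u v = cocycle_data.total_map n (psi_D j k) (psi_\<alpha> j k) (psi_\<beta> j k) u v"
proof -
  note E = elem_apply[OF uv]
  note S = sum_elem_uminus sum_elem_vscale
  note R = sum_elem_shift[OF uv, simplified]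
  note T = cocycle_data.total_map_def[OF psi_data[OF jk]]
  note D = psi_D_def psi_\<alpha>_def psi_\<beta>_def
  have DT: "psi_D j k (shift n u) = vscale (u (Y j)) (yv k)"
    using jk by (auto simp: psi_D_def psi_index_def)
  \<comment> \<open>The zero for k = n+1 comes from T y_{n+1} = 0; it is why
    \<open>psi n j (n+1)\<close> has no value on (x_j, x_1).\<close>
  have TD: "shift n (psi_D j k u) = vscale (u (X j)) (if k \<le> n then xv k else 0)"
    using jk by (auto simp: psi_D_def psi_index_def shift_scale shift_basis le_Suc_eq)
  consider "k = 1" "j < n" | "2 \<le> k" "k \<le> n" | "k = n + 1" "n \<ge> 1"
    using jk by (force simp: psi_index_def)
  then show ?thesis
  proof cases
    case 1
    then show ?thesis
      unfolding T DT TD by (simp add: psi_def S E D R; simp add: fun_eq_iff numeral_2_eq_2 algebra_simps)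
  next
    case 2
    then show ?thesis
      unfolding T DT TD by (auto simp: psi_def S E D fun_eq_iff field_simps)
  next
    case 3
    then show ?thesis
      unfolding T DT TD by (auto simp: psi_def S E D fun_eq_iff field_simps)
  qed
qed

lemma phi_cocycle:
  assumes "n \<ge> 1" "(j, k) \<in> phi_index n"
  shows "phi n j k \<in> (NF_cocycles n :: 'a::field_char_0 bimap set)"
proof -
  interpret cocycle_data n "phi_D n j k :: 'a vec \<Rightarrow> 'a vec" "phi_\<alpha> n j k" "phi_\<beta> n j k"
    by (rule phi_data[OF assms])
  have "phi n j k u v = deform u v" for u v
  proof (cases "u \<in> whole (NF n) \<and> v \<in> whole (NF n)")
    case True
    then show ?thesis by (simp add: deform_def phi_total[OF assms])
  next
    case False
    then have outside: "u \<notin> whole (NF n) \<or> v \<notin> whole (NF n)" by blast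
    then have "elem n g h w u v = 0" for g h w by (auto simp: elem_def)
    then have "phi n j k u v = 0"
      by (simp add: phi_def sum_elem_outside[OF outside])
    then show ?thesis using False by (auto simp: deform_def)
  qed
  then have "phi n j k = deform" by (intro ext) simp
  then show ?thesis by (simp add: deform_cocycle)
qed

lemma psi_cocycle:
  assumes "(j, k) \<in> psi_index n"
  shows "psi n j k \<in> (NF_cocycles n :: 'a::field_char_0 bimap set)"
proof -
  interpret cocycle_data n "psi_D j k :: 'a vec \<Rightarrow> 'a vec" "psi_\<alpha> j k" "psi_\<beta> j k"
    by (rule psi_data[OF assms])
  have "psi n j k u v = deform u v" for u v
  proof (cases "u \<in> whole (NF n) \<and> v \<in> whole (NF n)")
    case True
    then show ?thesis by (simp add: deform_def psi_total[OF assms])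
  next
    case False
    then have outside: "u \<notin> whole (NF n) \<or> v \<notin> whole (NF n)" by blast
    then have "elem n g h w u v = 0" for g h w by (auto simp: elem_def)
    then have "psi n j k u v = 0"
      by (simp add: psi_def sum_elem_outside[OF outside])
    then show ?thesis using False by (auto simp: deform_def)
  qed
  then have "psi n j k = deform" by (intro ext) simp
  then show ?thesis by (simp add: deform_cocycle)
qed

text \<open>The normalization \<alpha>(y_1) = 0, together with \<beta>(y_1) = 0, makes D recoverable
  from the map.\<close>

lemma phi_apply_y1:
  fixes u :: "'a::field_char_0 vec"
  assumes "n \<ge> 1" "(j, k) \<in> phi_index n" "u \<in> whole (NF n)"
  shows "phi n j k u (yv 1) = phi_D n j k u"
proof -
  have y1: "(yv 1 :: 'a vec) \<in> whole (NF n)" by (auto simp: mem_whole_NF_iff yv_def)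
  show ?thesis
    unfolding phi_total[OF assms y1] cocycle_data.total_map_def[OF phi_data[OF assms(1,2)]]
    using assms(1) by (simp add: phi_\<alpha>_def phi_\<beta>_def yv_def fun_eq_iff)
qed

lemma psi_apply_y1:
  fixes u :: "'a::field_char_0 vec"
  assumes "(j, k) \<in> psi_index n" "u \<in> whole (NF n)"
  shows "psi n j k u (yv 1) = psi_D j k u"
proof -
  have y1: "(yv 1 :: 'a vec) \<in> whole (NF n)" by (auto simp: mem_whole_NF_iff yv_def)
  have "j \<ge> 1" using assms(1) by (auto simp: psi_index_def)
  then show ?thesis
    unfolding psi_total[OF assms y1] cocycle_data.total_map_def[OF psi_data[OF assms(1)]]
    by (simp add: psi_\<alpha>_def psi_\<beta>_def yv_def fun_eq_iff)
qed

subsection \<open>A cocycle is determined by its dual coordinates\<close>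

lemma whole_NF_induct [consumes 1, case_names xv yv add scale]:
  fixes u :: "'a::field vec"
  assumes "u \<in> whole (NF n)"
    and xv: "\<And>i. 1 \<le> i \<Longrightarrow> i \<le> n \<Longrightarrow> P (xv i)"
    and yv: "\<And>i. 1 \<le> i \<Longrightarrow> i \<le> n + 1 \<Longrightarrow> P (yv i)"
    and add: "\<And>v w. v \<in> whole (NF n) \<Longrightarrow> w \<in> whole (NF n) \<Longrightarrow> P v \<Longrightarrow> P w \<Longrightarrow> P (v + w)"
    and scale: "\<And>c v. v \<in> whole (NF n) \<Longrightarrow> P v \<Longrightarrow> P (vscale c v)"
  shows "P u"
proof -
  have W: "(xv i :: 'a vec) \<in> whole (NF n)" if "i \<in> {1..n}" for i
    using that by (auto simp: mem_whole_NF_iff xv_def)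
  have W': "(yv i :: 'a vec) \<in> whole (NF n)" if "i \<in> {1..n+1}" for i
    using that by (auto simp: mem_whole_NF_iff yv_def)
  \<comment> \<open>The base vector y_1 exists for every n, so scaling it by 0 yields the case of
    the zero vector.\<close>
  have zero: "(0 :: 'a vec) \<in> whole (NF n)" "P 0"
    using W'[of 1] scale[OF W'[of 1] yv[of 1], of 0] by (auto simp: mem_whole_NF_iff vscale_def zero_fun_def)
  have sum: "(\<Sum>i\<in>I. vscale (r i) (b i)) \<in> whole (NF n) \<and> P (\<Sum>i\<in>I. vscale (r i) (b i))"
    if "\<And>i. i \<in> I \<Longrightarrow> b i \<in> whole (NF n) \<and> P (b i)" for I r and b :: "nat \<Rightarrow> 'a vec"
    using that by (induction I rule: infinite_finite_induct) (auto simp: zero whole_NF_add whole_NF_scale add scale)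
  have app: "(\<Sum>i\<in>I. vscale (r i) (b i)) g = (\<Sum>i\<in>I. r i * b i g)" for I r g and b :: "nat \<Rightarrow> 'a vec"
    by (induction I rule: infinite_finite_induct) auto
  have "u = (\<Sum>i=1..n. vscale (u (X i)) (xv i)) + (\<Sum>i=1..n+1. vscale (u (Y i)) (yv i))" (is "_ = ?s + ?t")
  proof (rule vec_eqI)
    show "u (X l) = (?s + ?t) (X l)" for l
      using assms(1) sum_mult_delta(1)[of "{1..n}" "\<lambda>i. u (X i)" l]
      by (auto simp: app xv_def yv_def mem_whole_NF_iff)
    show "u (Y l) = (?s + ?t) (Y l)" for l
      using assms(1) sum_mult_delta(1)[of "{1..n+1}" "\<lambda>i. u (Y i)" l]
      by (auto simp: app xv_def yv_def mem_whole_NF_iff simp del: sum.cl_ivl_Suc)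
  qed
  moreover have "P (?s + ?t)"
  proof (rule add)
    show "?s \<in> whole (NF n)" "P ?s" using sum[of "{1..n}" xv] W xv by auto
    show "?t \<in> whole (NF n)" "P ?t" using sum[of "{1..n+1}" yv] W' yv by (auto simp del: sum.cl_ivl_Suc)
  qed
  ultimately show ?thesis by metis
qed

section \<open>Closure of the cocycles under linear combinations\<close>

lemma bilinear_onD:
  assumes "bilinear_on vscale (whole (NF n)) f"
  shows "u \<in> whole (NF n) \<Longrightarrow> v \<in> whole (NF n) \<Longrightarrow> f u v \<in> whole (NF n)"
    and "u \<in> whole (NF n) \<Longrightarrow> u' \<in> whole (NF n) \<Longrightarrow> v \<in> whole (NF n) \<Longrightarrow> f (u + u') v = f u v + f u' v"
    and "u \<in> whole (NF n) \<Longrightarrow> v \<in> whole (NF n) \<Longrightarrow> v' \<in> whole (NF n) \<Longrightarrow> f u (v + v') = f u v + f u v'"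
    and "u \<in> whole (NF n) \<Longrightarrow> v \<in> whole (NF n) \<Longrightarrow> f (vscale c u) v = vscale c (f u v)"
    and "u \<in> whole (NF n) \<Longrightarrow> v \<in> whole (NF n) \<Longrightarrow> f u (vscale c v) = vscale c (f u v)"
    and "u \<notin> whole (NF n) \<or> v \<notin> whole (NF n) \<Longrightarrow> f u v = 0"
  using assms unfolding bilinear_on_def by blast+

lemma subspace_NF_cocycles:
  "module.subspace bscale (NF_cocycles n :: 'a::field_char_0 bimap set)"
proof -
  interpret vector_space "bscale :: 'a \<Rightarrow> 'a bimap \<Rightarrow> 'a bimap" by (rule vector_space_bscale)
  note B = bilinear_onD[OF bilinear_on_NF_bracket]
  define E where "E f u v w b c = NF_bracket n u (f v w) - NF_bracket n (f u v) w
      + vscale (koszul_sign b c) (NF_bracket n (f u w) v) + f u (NF_bracket n v w)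
      - f (NF_bracket n u v) w + vscale (koszul_sign b c) (f (NF_bracket n u w) v)"
    for f :: "'a bimap" and u v w b c
  have mem_iff: "f \<in> NF_cocycles n \<longleftrightarrow> bilinear_on vscale (whole (NF n)) f \<and> even_map (NF n) f \<and>
      (\<forall>a b c. \<forall>u\<in>NF n a. \<forall>v\<in>NF n b. \<forall>w\<in>NF n c. E f u v w b c = 0)" for f :: "'a bimap"
    by (simp add: even_2_cocycles_def E_def)
  have app: "(bscale r f + g) u v = vscale r (f u v) + g u v" for r and f g :: "'a bimap" and u v
    by (rule ext) (simp add: bscale_def)
  \<comment> \<open>One closure property covers both operations: r = 1 gives sums and g = 0 gives
    multiples.\<close>
  have lin: "bscale r f + g \<in> NF_cocycles n"
    if f: "f \<in> NF_cocycles n" and g: "g \<in> NF_cocycles n" for r and f g :: "'a bimap"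
    unfolding mem_iff
  proof (intro conjI allI ballI)
    have fg: "bilinear_on vscale (whole (NF n)) f" "bilinear_on vscale (whole (NF n)) g"
      "even_map (NF n) f" "even_map (NF n) g"
      using f g by (simp_all add: mem_iff)
    note F = bilinear_onD[OF fg(1)] and G = bilinear_onD[OF fg(2)]
    show "bilinear_on vscale (whole (NF n)) (bscale r f + g)"
      unfolding bilinear_on_def app
      by (intro conjI allI ballI impI; simp only: F G whole_NF_add whole_NF_scale;
          simp add: fun_eq_iff algebra_simps)
    show "even_map (NF n) (bscale r f + g)"
      using fg(3,4) unfolding even_map_def app by (blast intro: NF_add NF_scale)
    fix a b c and u v w :: "'a vec" assume uvw: "u \<in> NF n a" "v \<in> NF n b" "w \<in> NF n c"
    have "E (bscale r f + g) u v w b c = vscale r (E f u v w b c) + E g u v w b c"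
      using uvw[THEN NF_subset_whole] unfolding E_def app
      by (simp only: B F G whole_NF_add whole_NF_scale) (simp add: fun_eq_iff algebra_simps)
    then show "E (bscale r f + g) u v w b c = 0"
      using f g uvw by (simp add: mem_iff fun_eq_iff)
  qed
  have zero: "(0 :: 'a bimap) \<in> NF_cocycles n"
  proof -
    have z: "(0 :: 'a vec) \<in> whole (NF n)" by (simp add: mem_whole_NF)
    have v0: "vscale r (0 :: 'a vec) = 0" "vscale 0 u = 0" for r and u :: "'a vec"
      by (simp_all add: fun_eq_iff)
    have b0: "NF_bracket n u 0 = (0 :: 'a vec)" "NF_bracket n 0 u = (0 :: 'a vec)"
      if "u \<in> whole (NF n)" for u :: "'a vec"
      using B(4)[OF z that, of 0] B(5)[OF that z, of 0] by (simp_all add: v0)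
    have app0: "(0 :: 'a bimap) u v = 0" for u v
      by simp
    have "bilinear_on vscale (whole (NF n)) (0 :: 'a bimap) \<and> even_map (NF n) (0 :: 'a bimap) \<and>
      (\<forall>a b c. \<forall>u\<in>NF n a. \<forall>v\<in>NF n b. \<forall>w\<in>NF n c. E 0 u v w b c = 0)"
    proof (intro conjI allI ballI)
      show "bilinear_on vscale (whole (NF n)) (0 :: 'a bimap)"
        unfolding bilinear_on_def app0 v0 using z by simp
      show "even_map (NF n) (0 :: 'a bimap)"
        unfolding even_map_def app0 using NF_zero by blast
      show "E 0 u v w b c = 0" if "u \<in> NF n a" "v \<in> NF n b" "w \<in> NF n c" for a b c u v w
        unfolding E_def app0 using that[THEN NF_subset_whole] by (simp only: b0 v0) simp
    qed    then show ?thesis unfolding mem_iff .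

  qed
  show ?thesis
    using zero lin[of _ _ 1] lin[OF _ zero] by (intro subspaceI) (auto simp: scale_one)
qed

text \<open>The hypotheses kill every entry of f(., y_1) except c, the one from x_n to y_1. Climbing
  the chain y_1, x_1, y_2, x_2, ..., y_{n+1} by T, up to scalars, propagates this to all second
  arguments, and T y_{n+1} = 0 at the end forces c = 0.\<close>

lemma cocycle_eq_0:
  fixes f :: "'a::field_char_0 bimap"
  assumes n: "n \<ge> 1" and f: "f \<in> NF_cocycles n"
    and phi0: "\<And>j k. (j, k) \<in> phi_index n \<Longrightarrow> f (yv j) (yv 1) (X k) = 0"
    and psi0: "\<And>j k. (j, k) \<in> psi_index n \<Longrightarrow> f (xv j) (yv 1) (Y k) = 0"
  shows "f = 0"
proof -
  have bil: "bilinear_on vscale (whole (NF n)) f" and even: "even_map (NF n) f"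
    and coc: "\<And>a b c u v w. u \<in> NF n a \<Longrightarrow> v \<in> NF n b \<Longrightarrow> w \<in> NF n c \<Longrightarrow>
      NF_bracket n u (f v w) - NF_bracket n (f u v) w + vscale (koszul_sign b c) (NF_bracket n (f u w) v)
            + f u (NF_bracket n v w) - f (NF_bracket n u v) w + vscale (koszul_sign b c) (f (NF_bracket n u w) v) = 0"
    using f unfolding even_2_cocycles_def by blast+
  note bilD = bilinear_onD[OF bil]
  have x: "(xv i :: 'a vec) \<in> NF n 0" if "1 \<le> i" "i \<le> n" for i
    using that by (auto simp: NF_0_iff xv_def)
  have y: "(yv i :: 'a vec) \<in> NF n 1" if "1 \<le> i" "i \<le> n + 1" for i
    using that by (auto simp: NF_1_iff yv_def)
  have xW: "(xv i :: 'a vec) \<in> whole (NF n)" if "1 \<le> i" "i \<le> n" for i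
    using x[OF that] by (rule NF_subset_whole)
  have yW: "(yv i :: 'a vec) \<in> whole (NF n)" if "1 \<le> i" "i \<le> n + 1" for i
    using y[OF that] by (rule NF_subset_whole)
  define c where "c = f (xv n) (yv 1) (Y 1)"
  define H where "H u = vscale (c * u (X n)) (yv 1)" for u :: "'a vec"
  have H: "f u (yv 1) = H u" if "u \<in> whole (NF n)" for u
    using that
  proof (induction u rule: whole_NF_induct)
    case (xv i)
    have "f (xv i) (yv 1) \<in> NF n 1"
      using even x[OF xv] y[of 1] unfolding even_map_def by force
    then have "f (xv i) (yv 1) (X l) = 0" "l \<notin> {1..n+1} \<Longrightarrow> f (xv i) (yv 1) (Y l) = 0" for l
      unfolding NF_1_iff by auto
    moreover have "f (xv i) (yv 1) (Y l) = 0" if "l \<in> {1..n+1}" "(i, l) \<noteq> (n, 1)" for l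
      using that xv by (intro psi0) (auto simp: psi_index_def)
    ultimately show ?case
      unfolding H_def by (intro vec_eqI) (auto simp: c_def xv_def yv_def)
  next
    case (yv i)
    have "f (yv i) (yv 1) \<in> NF n 0"
      using even y[OF yv] y[of 1] unfolding even_map_def by force
    then have "f (yv i) (yv 1) (Y l) = 0" "l \<notin> {1..n} \<Longrightarrow> f (yv i) (yv 1) (X l) = 0" for l
      unfolding NF_0_iff by auto
    moreover have "f (yv i) (yv 1) (X l) = 0" if "l \<in> {1..n}" for l
      using that yv by (intro phi0) (auto simp: phi_index_def)
    ultimately show ?case
      unfolding H_def by (intro vec_eqI) (auto simp: yv_def)
  next
    case (add u v)
    have "f (u + v) (yv 1) = f u (yv 1) + f v (yv 1)"
      using add yW[of 1] by (intro bilD) auto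
    also have "\<dots> = H (u + v)"
      unfolding add.IH by (simp add: H_def fun_eq_iff algebra_simps)
    finally show ?case .
  next
    case (scale r u)
    have "f (vscale r u) (yv 1) = vscale r (f u (yv 1))"
      using scale yW[of 1] by (intro bilD) auto
    also have "\<dots> = H (vscale r u)"
      unfolding scale.IH by (simp add: H_def fun_eq_iff)
    finally show ?case .
  qed
  have br: "NF_bracket n u v = vscale (v (Y 1)) (shift n u) + vscale (2 * v (X 1)) (shift n (shift n u))"
    if "u \<in> whole (NF n)" "v \<in> whole (NF n)" for u v :: "'a vec"
    using that by (rule NF_bracket_eq)
  have HW: "H u \<in> whole (NF n)" for u
    unfolding H_def using yW[of 1] by (simp add: whole_NF_scale)
  have b1: "NF_bracket n w (yv 1) = shift n w" if "w \<in> whole (NF n)" for w :: "'a vec"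
    using that yW[of 1] by (simp add: br) (simp add: yv_def fun_eq_iff)
  have b0: "NF_bracket n w 0 = 0" if "w \<in> whole (NF n)" for w :: "'a vec"
    using that by (simp add: br mem_whole_NF) (simp add: fun_eq_iff)
  \<comment> \<open>The cocycle identity with y_1 as last argument, solved for f(u, T v); the sign
    is the Koszul sign of v and y_1.\<close>
  have step: "f u (shift n v) = shift n (f u v) - NF_bracket n u (H v) + H (NF_bracket n u v)
      - vscale (if b = 1 then -1 else 1) (NF_bracket n (H u) v + f (shift n u) v)"
    if u: "u \<in> NF n a" and v: "v \<in> NF n b" for u v a b
  proof -
    have W: "u \<in> whole (NF n)" "v \<in> whole (NF n)" using u v by (auto intro: NF_subset_whole)
    have "koszul_sign b 1 = (if b = 1 then -1 else (1 :: 'a))" by (simp add: koszul_sign_def)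
    then show ?thesis
      using coc[OF u v y[of 1]] W
      by (simp only: b1 H bilD NF_bracket_mem whole_shift le_refl le_add2) (simp add: fun_eq_iff algebra_simps)
  qed
  have H_simps: "H (xv i) = (if i = n then vscale c (yv 1) else 0)" "H (yv i) = 0" "H 0 = 0"
    "H (u + v) = H u + H v" "H (vscale r u) = vscale r (H u)" for i u v r
    by (auto simp: H_def fun_eq_iff xv_def yv_def algebra_simps)
  have zeros: "shift n 0 = (0 :: 'a vec)" "vscale 0 u = 0" "vscale r 0 = 0" for r and u :: "'a vec"
    by (auto intro!: vec_eqI)
  have f_x1: "f u (xv 1) = vscale 2 (shift n (H u) + H (shift n u))" if u: "u \<in> NF n a" for u a
  proof -
    have "u \<in> whole (NF n)" using u by (rule NF_subset_whole)
    then show ?thesis using step[OF u y[of 1]] n yW[of 1]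
      by (simp add: shift_basis b1[simplified] b0 H_simps H[simplified] whole_shift HW)
        (simp add: fun_eq_iff)
  qed
  have f_scale: "f u w = vscale 2 (f u (shift n v))" if "shift n v = vscale (1 / 2) w" "u \<in> NF n a" "w \<in> whole (NF n)" for u v w a
    unfolding that(1) bilD(5)[OF NF_subset_whole[OF that(2)] that(3)] by (simp add: fun_eq_iff)
  \<comment> \<open>Only H(x_n) = c y_1 is nonzero on the basis, so c first shows at y_{n+1} = 2 T
    x_n, contributing -2 [u, c y_1] = -2 c T u.\<close>
  have f_y: "\<forall>a. \<forall>u\<in>NF n a. f u (yv (i + 1)) = vscale (if i = n then - 2 * c else 0) (shift n u)"
    and f_x: "i < n \<longrightarrow> (\<forall>a. \<forall>u\<in>NF n a. f u (xv (i + 1)) = 0)" if "1 \<le> i" "i \<le> n" for i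
  proof -
    \<comment> \<open>The vanishing at x_{i+1} = T y_{i+1} follows from the claim for y_{i+1} alone.
      It is stated for arbitrary i because it is needed both inside the induction and after
      it.\<close>
    have f_xI: "f u (xv (i + 1)) = 0"
      if i: "1 \<le> i" "i < n" and u: "u \<in> NF n a"
        and IH: "\<And>u a. u \<in> NF n a \<Longrightarrow> f u (yv (i + 1)) = vscale (if i = n then - 2 * c else 0) (shift n u)" for i u a
    proof -
      have W: "u \<in> whole (NF n)" using u by (rule NF_subset_whole)
      have z: "NF_bracket n w (yv (i + 1)) = 0" if "w \<in> whole (NF n)" for w :: "'a vec"
        using i that yW[of "i + 1"] by (simp add: br) (simp add: yv_def fun_eq_iff)
      show ?thesis
        using step[OF u y[of "i + 1"]] i IH[OF u] IH[OF NF_shift[OF u]]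
        by (simp add: shift_basis H_simps zeros z[simplified] b0 HW W)
    qed
    have "\<forall>a. \<forall>u\<in>NF n a. f u (yv (i + 1)) = vscale (if i = n then - 2 * c else 0) (shift n u)"
      using that
    proof (induction i rule: nat_induct_at_least)
      case base
      show ?case
      proof (intro allI ballI)
        fix a and u :: "'a vec" assume u: "u \<in> NF n a"
        have W: "u \<in> whole (NF n)" using u by (rule NF_subset_whole)
        have "f u (yv 2) = vscale 2 (f u (shift n (xv 1)))"
          using n u yW[of 2] by (intro f_scale) (auto simp: shift_basis numeral_2_eq_2)
        \<comment> \<open>Inserting \<open>f_x1\<close> for u and T u, all terms cancel except the
          one with H(x_1), which is nonzero only when n = 1.\<close>
        also have "f u (shift n (xv 1)) = - NF_bracket n u (H (xv 1))"
          using n W HW xW[of 1] step[OF u x[of 1]] f_x1[OF u] f_x1[OF NF_shift[OF u]]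
          by (simp add: br whole_shift H_simps zeros shift_add shift_scale)
            (simp add: xv_def fun_eq_iff algebra_simps)
        finally show "f u (yv (1 + 1)) = vscale (if 1 = n then - 2 * c else 0) (shift n u)"
          using W HW n by (simp add: br numeral_2_eq_2) (auto simp: fun_eq_iff H_def xv_def yv_def)
      qed
    next
      case (Suc i)
      show ?case
      proof (intro allI ballI)
        fix a and u :: "'a vec" assume u: "u \<in> NF n a"
        have W: "u \<in> whole (NF n)" using u by (rule NF_subset_whole)
        have fx: "f u (xv (i + 1)) = 0" if "u \<in> NF n a" for u a
          using Suc that by (intro f_xI) auto
        have z: "NF_bracket n w (xv (i + 1)) = 0" if "w \<in> whole (NF n)" for w :: "'a vec"
          using Suc that xW[of "i + 1"] by (simp add: br) (simp add: xv_def fun_eq_iff)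
        have "f u (yv (Suc (Suc i))) = vscale 2 (f u (shift n (xv (i + 1))))"
          using Suc u yW[of "Suc (Suc i)"] by (intro f_scale) (auto simp: shift_basis)
        also have "f u (shift n (xv (i + 1))) = - NF_bracket n u (H (xv (i + 1)))"
          using W HW fx[OF u] fx[OF NF_shift[OF u]] Suc
          by (simp add: step[OF u x[of "i + 1", simplified]] z[simplified] H_simps zeros)
        finally show "f u (yv (Suc i + 1)) = vscale (if Suc i = n then - 2 * c else 0) (shift n u)"
          using W HW n by (simp add: br) (auto simp: fun_eq_iff H_def xv_def yv_def)
      qed
    qed
    then show "\<forall>a. \<forall>u\<in>NF n a. f u (yv (i + 1)) = vscale (if i = n then - 2 * c else 0) (shift n u)"
      and "i < n \<longrightarrow> (\<forall>a. \<forall>u\<in>NF n a. f u (xv (i + 1)) = 0)"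
      using f_xI that by blast+
  qed
  have c0: "c = 0"
  proof -
    have z: "NF_bracket n w (yv (n + 1)) = 0" if "w \<in> whole (NF n)" for w :: "'a vec"
      using n that yW[of "n + 1"] by (simp add: br) (simp add: yv_def fun_eq_iff)
    have zW: "(0 :: 'a vec) \<in> whole (NF n)" by (simp add: mem_whole_NF)
    have f0: "f (yv 1) 0 = 0"
      using bilD(5)[OF yW[of 1] yW[of 1], of 0] by (simp add: vscale_def zero_fun_def)
    have fy: "f u (yv (n + 1)) = vscale (- 2 * c) (shift n u)" if "u \<in> NF n a" for u a
      using f_y[of n] n that by auto
    have half: "shift n (shift n (yv 1)) (Y 2) = (1 / 2 :: 'a)" using n by (simp add: yv_def)
    \<comment> \<open>Here u = y_1 and v = y_{n+1}, so the left side of \<open>step\<close> is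
      f(y_1, 0) = 0. Since both arguments are odd, the two contributions -2 c T T y_1 add up instead
      of cancelling.\<close>
    have "vscale (- 4 * c) (shift n (shift n (yv 1))) = 0"
      using step[OF y[of 1] y[of "n + 1"]] fy[OF y[of 1]] fy[OF NF_shift[OF y[of 1]]]
      by (simp add: shift_basis f0[simplified] H_simps zeros zW z[simplified] b0 HW yW shift_scale)
        (simp add: fun_eq_iff algebra_simps)
    from fun_cong[OF this, of "Y 2"] have "- 4 * c * (1 / 2) = 0"
      by (simp only: vscale_apply half zero_fun_apply)
    then show ?thesis by simp
  qed
  then have H0: "H u = 0" for u by (simp add: H_def fun_eq_iff)
  have hom: "f u v = 0" if u: "u \<in> NF n a" and v: "v \<in> whole (NF n)" for u v a
    using v
  proof (induction v rule: whole_NF_induct)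
    case (xv i)
    then show ?case using f_x1[OF u] f_x[of "i - 1"] u
      by (cases "i = 1") (auto simp: H0 zeros fun_eq_iff)
  next
    case (yv i)
    then show ?case using H[OF NF_subset_whole[OF u]] f_y[of "i - 1"] u c0
      by (cases "i = 1") (auto simp: H0 zeros fun_eq_iff)
  next
    case (add v w)
    then show ?case
      unfolding bilD(3)[OF NF_subset_whole[OF u] add.hyps] by simp
  next
    case (scale r v)
    then show ?case
      unfolding bilD(5)[OF NF_subset_whole[OF u] scale.hyps] by (simp only: zeros)
  qed
  have "f u v = 0" for u v
  proof (cases "u \<in> whole (NF n) \<and> v \<in> whole (NF n)")
    case True
    then obtain u0 u1 where "u = u0 + u1" "u0 \<in> NF n 0" "u1 \<in> NF n 1"
      unfolding whole_def by blast
    with True show ?thesis by (auto simp: bilD(2)[OF NF_subset_whole NF_subset_whole] hom)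
  qed (auto simp: bilD)
  then show ?thesis by (simp add: fun_eq_iff)
qed

subsection \<open>The basis\<close>

text \<open>Biorthogonality of c and b gives injectivity and independence; the separation property
  \<open>zero\<close> gives spanning, so no dimension count is needed.\<close>

lemma is_basis_ofI:
  assumes "vector_space scale" and W: "module.subspace scale W" and I: "finite I"
    and b: "\<And>i. i \<in> I \<Longrightarrow> b i \<in> W"
    and c_add: "\<And>i v w. c i (v + w) = c i v + c i w"
    and c_scale: "\<And>i r v. c i (scale r v) = r * c i v"
    and dual: "\<And>i j. i \<in> I \<Longrightarrow> j \<in> I \<Longrightarrow> c i (b j) = (if i = j then 1 else 0)"
    and zero: "\<And>w. w \<in> W \<Longrightarrow> (\<And>i. i \<in> I \<Longrightarrow> c i w = 0) \<Longrightarrow> w = 0"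
  shows "is_basis_of scale b I W"
proof -
  interpret vector_space scale by fact
  have inj: "inj_on b I"
    by (rule inj_onI) (metis dual zero_neq_one)
  have c_0: "c i 0 = 0" for i using c_scale[of i 0 0] by simp
  have c_sum: "c i (\<Sum>j\<in>I. scale (r j) (b j)) = r i" if "i \<in> I" for r i
  proof -
    have "c i (\<Sum>j\<in>J. scale (r j) (b j)) = (\<Sum>j\<in>J. r j * c i (b j))" for J
      by (induction J rule: infinite_finite_induct) (simp_all add: c_0 c_add c_scale)
    also have "(\<Sum>j\<in>I. r j * c i (b j)) = (\<Sum>j\<in>I. if j = i then r j else 0)"
      using that by (intro sum.cong) (auto simp: dual)
    finally show ?thesis using I that by simp
  qed
  have "independent (b ` I)"
    unfolding dependent_finite[OF finite_imageI[OF I]]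
  proof (intro notI, elim exE conjE bexE imageE)
    fix r v i
    assume "(\<Sum>v\<in>b ` I. scale (r v) v) = 0" and i: "i \<in> I" "v = b i" "r v \<noteq> 0"
    then have "(\<Sum>j\<in>I. scale (r (b j)) (b j)) = 0" by (simp add: sum.reindex[OF inj])
    then show False using c_sum[OF i(1), of "\<lambda>j. r (b j)"] i by (simp add: c_0)
  qed
  moreover have "span (b ` I) = W"
  proof (rule antisym)
    show "span (b ` I) \<subseteq> W" using b W by (intro span_minimal) auto
    show "W \<subseteq> span (b ` I)"
    proof
      fix w assume w: "w \<in> W"
      \<comment> \<open>The expansion of w with its own coordinates: w - s lies in W and has all
        coordinates zero.\<close>
      define s where "s = (\<Sum>i\<in>I. scale (c i w) (b i))"
      have s: "s \<in> span (b ` I)"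
        unfolding s_def by (intro span_sum span_scale span_base) auto
      have "s \<in> W"
        unfolding s_def using W b by (intro subspace_sum subspace_scale) auto
      moreover have "c i (w - s) = 0" if "i \<in> I" for i
        using c_add[of i "w - s" s] c_sum[OF that, of "\<lambda>i. c i w"] by (simp add: s_def)
      ultimately have "w - s = 0"
        using w W by (intro zero subspace_diff)
      with s show "w \<in> span (b ` I)" by simp
    qed
  qed
  ultimately show ?thesis using inj by (simp add: is_basis_of_def)
qed

definition cocycle_coord :: "(nat \<times> nat) + (nat \<times> nat) \<Rightarrow> 'a::field bimap \<Rightarrow> 'a" where
  "cocycle_coord = case_sum (\<lambda>(j, k) f. f (yv j) (yv 1) (X k)) (\<lambda>(j, k) f. f (xv j) (yv 1) (Y k))"

lemma cocycle_coord_family: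
  assumes "n \<ge> 1" "p \<in> phi_index n <+> psi_index n" "q \<in> phi_index n <+> psi_index n"
  shows "cocycle_coord p (cocycle_family n q :: 'a::field_char_0 bimap) = (if p = q then 1 else 0)"
proof -
  have x: "(xv j :: 'a vec) \<in> whole (NF n)" if "(j, k) \<in> psi_index n" for j k
    using that by (auto simp: psi_index_def mem_whole_NF_iff xv_def)
  have y: "(yv j :: 'a vec) \<in> whole (NF n)" if "(j, k) \<in> phi_index n" for j k
    using that by (auto simp: phi_index_def mem_whole_NF_iff yv_def)
  have mem: "Inl a \<in> A <+> B \<longleftrightarrow> a \<in> A" "Inr b \<in> A <+> B \<longleftrightarrow> b \<in> B" for a b A B
    by auto
  note apply_y1 = phi_apply_y1[OF assms(1)] psi_apply_y1
  show ?thesis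
  proof (cases p; cases q)
    fix a b assume pq: "p = Inl a" "q = Inl b"
    obtain j k j' k' where "a = (j, k)" "b = (j', k')" by (cases a, cases b)
    then show ?thesis
      using assms(2,3) y[of j k] unfolding pq mem cocycle_coord_def cocycle_family_def
      by (simp only: sum.case prod.case apply_y1)
        (simp add: phi_D_def xv_def yv_def)
  next
    fix a b assume pq: "p = Inl a" "q = Inr b"
    obtain j k j' k' where "a = (j, k)" "b = (j', k')" by (cases a, cases b)
    then show ?thesis
      using assms(2,3) y[of j k] unfolding pq mem cocycle_coord_def cocycle_family_def
      by (simp only: sum.case prod.case apply_y1)
        (simp add: psi_D_def xv_def yv_def)
  next
    fix a b assume pq: "p = Inr a" "q = Inl b"
    obtain j k j' k' where "a = (j, k)" "b = (j', k')" by (cases a, cases b)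
    \<comment> \<open>The correction in \<open>phi_D\<close> has a nonzero entry from x_n to y_1,
      but no coordinate reads it, since (n, 1) is not in \<open>psi_index n\<close>.\<close>
    then show ?thesis
      using assms(2,3) x[of j k] unfolding pq mem cocycle_coord_def cocycle_family_def
      by (simp only: sum.case prod.case apply_y1)
        (auto simp: phi_D_def psi_index_def xv_def yv_def)
  next
    fix a b assume pq: "p = Inr a" "q = Inr b"
    obtain j k j' k' where "a = (j, k)" "b = (j', k')" by (cases a, cases b)
    then show ?thesis
      using assms(2,3) x[of j k] unfolding pq mem cocycle_coord_def cocycle_family_def
      by (simp only: sum.case prod.case apply_y1)
        (simp add: psi_D_def xv_def yv_def)
  qed
qed

theorem theorem4p9:
  fixes n :: nat
  assumes "n \<ge> 1"
  shows "is_basis_of (bscale :: 'a::field_char_0 \<Rightarrow> 'a bimap \<Rightarrow> 'a bimap)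
           (cocycle_family n) (phi_index n <+> psi_index n) (NF_cocycles n)"
proof (rule is_basis_ofI[where c = cocycle_coord])
  show "finite (phi_index n <+> psi_index n)"
    by (simp add: phi_index_def psi_index_def)
  show "cocycle_family n p \<in> (NF_cocycles n :: 'a bimap set)" if "p \<in> phi_index n <+> psi_index n" for p
    using that assms by (auto simp: cocycle_family_def phi_cocycle psi_cocycle)
  show "cocycle_coord p (v + w) = cocycle_coord p v + cocycle_coord p w" for p and v w :: "'a bimap"
    by (auto simp: cocycle_coord_def split: sum.split)
  show "cocycle_coord p (bscale r v) = r * cocycle_coord p v" for p r and v :: "'a bimap"
    by (auto simp: cocycle_coord_def bscale_def split: sum.split)
  show "w = 0" if "w \<in> NF_cocycles n" and "\<And>p. p \<in> phi_index n <+> psi_index n \<Longrightarrow> cocycle_coord p w = 0"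
    for w :: "'a bimap"
    using assms that(1)
  proof (rule cocycle_eq_0)
    show "w (yv j) (yv 1) (X k) = 0" if "(j, k) \<in> phi_index n" for j k
      using \<open>\<And>p. _ \<Longrightarrow> cocycle_coord p w = 0\<close>[of "Inl (j, k)"] that by (auto simp: cocycle_coord_def)
    show "w (xv j) (yv 1) (Y k) = 0" if "(j, k) \<in> psi_index n" for j k
      using \<open>\<And>p. _ \<Longrightarrow> cocycle_coord p w = 0\<close>[of "Inr (j, k)"] that by (auto simp: cocycle_coord_def)
  qed
qed (use assms in \<open>simp_all add: vector_space_bscale subspace_NF_cocycles cocycle_coord_family\<close>)

end
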